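(* Let $W$ be an output symmetric discrete memoryless channel with dispersion $\nu>0$, $T\ge2$ an integer, $0<t<\frac13$, and let $V_n^*$ and $\delta_n'$ be as defined in the context. If $(V_n^* )^{Tn}(A|x^{Tn})\ge\frac{\delta_n'}{2}$ for some $x^{Tn}\in\mathcal{X}^{Tn}$ and $A\subseteq\mathcal{Y}^{Tn}$, then the conditional probability under the true channel $W$ is lower-bounded as $$W^{Tn}(A|x^{Tn})\ge\frac{\delta_n'}{4}\exp\Big\{-Tn\Big(D(V_n^*\|W|P_{x^{Tn}})+\eta_n\Big)\Big\}$$ for some $\eta_n=o(n^{-2t})$. (The condition $t<\frac13$ is crucial in the derivation of this bound.)
   Context: Conventions: all logs are to base 2, and $\exp$ is the inverse of $\log$; $[i:j]=\{i,\dots,j\}$, $x_i^j=(x_i,\dots,x_j)$, $x^j=x_1^j$; $T_k:=k+T-1$. Asymptotic notations ($o$, $\omega$, $\Theta$) are the usual ones, with the sequences in them positive. For a channel $V$, $V^l(y^l|x^l)=\prod_{i=1}^lV(y_i|x_i)$ and $V^l(A|x^l)=\sum_{y^l\in A}V^l(y^l|x^l)$. $P_{x^l}$ is the type of $x^l$: $P_{x^l}(x)=N_x(x^l)/l$, where $N_x(x^l)$ is the number of occurrences of $x$ in $x^l$. Channel: $\mathcal{X},\mathcal{Y}$ finite, $W(\cdot|x)$ a distribution on $\mathcal{Y}$ for each $x$. It is output symmetric if $\mathcal{Y}$ can be partitioned into disjoint subsets such that for each subset the matrix of transition probabilities has the property that each row is a permutation of each other row and each column is a permutation of each other column. $I(P,V)$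 is the mutual information of input distribution $P$ and channel $V$; $C(V)=\max_PI(P,V)$; $C=C(W)$. Dispersion: $\nu=\min_{P:I(P,W)=C}\mathrm{E}[\mathrm{Var}[i(X;Y)|X]]$, $X\sim P$, $Y|X\sim W$, $i(x;y)=\log\frac{W(y|x)}{PW(y)}$, $PW(y)=\sum_xP(x)W(y|x)$. $D(V\|W|P)=\sum_xP(x)\sum_yV(y|x)\log\frac{V(y|x)}{W(y|x)}$. Parameters: $\log M_n=nC-n^{1-t}$; $R_n=\frac1n\log M_n=C-n^{-t}$; $S_n=\omega(n^t)$; $\zeta=\frac12(\frac13-t)$; $S_n^*=\min\{S_n,\exp\{n^{(1-3(t+\zeta))/4}\}\}$; $\delta_n=\frac{(T-1)R_n}{S_n^*+T-1}$; and $V_n^*$ is a minimizer, over channels $V$ from $\mathcal{X}$ to $\mathcal{Y}$ with $C(V)\le R_n-2\delta_n$, of $\max_PD(V\|W|P)$ (maximum over all distributions $P$ on $\mathcal{X}$). Code and $\delta_n'$: messages $G_1,\dots,G_{S_n}$ are independent and uniform on $\mathcal{G}=[1:M_n]$. In block $k\in[1:S_n+T-1]$, $\mathbf{X}_k=\phi_k(G^{\min\{k,S_n\}})\in\mathcal{X}^n$ is sent over $n$ memoryless channel uses (no feedback) and $\mathbf{Y}_k\in\mathcal{Y}^n$ is received. The decoding functions $\psi_k^*:\mathcal{G}^{k-1}\times\mathcal{Y}^{Tn}\to\mathcal{G}$, $k\in[1:S_n]$, take the true previous messages and the outputs of the latest $T$ blocks, giving $\hat G_k=\psi_k^*(G^{k-1},\mathbf{Y}_k^{T_k})$,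 and are optimal: under channel $W$, $\Pr(G_k\ne\psi_k^*(G^{k-1},\mathbf{Y}_k^{T_k}))\le\Pr(G_k\ne\psi_k^f(G^{k-1},\mathbf{Y}^{T_k}))$ for every $\psi_k^f:\mathcal{G}^{k-1}\times\mathcal{Y}^{T_kn}\to\mathcal{G}$. The sequence $\delta_n'=\Theta\!\left(\frac{\delta_n}{-\log\delta_n}\right)$ is one (known to exist) such that $\max_{k\in[1:S_n^*]}\Pr(\hat G_k\ne G_k)\ge\delta_n'$ when this code (same $\phi_k$, $\psi_k^*$) is applied to the channel $V_n^*$ in place of $W$. *)

theory Defs
  imports
    "HOL-Probability.Probability"
    "HOL-Combinatorics.Permutations"
    "HOL-Library.Landau_Symbols"
begin

section \<open>Channels and information quantities\<close>

text \<open>A channel is a function \<open>'x \<Rightarrow> 'y pmf\<close> between finite types. Finite sequences over an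
  alphabet are lists. All logarithms are to base 2.\<close>

definition joint_pmf :: "'x pmf \<Rightarrow> ('x \<Rightarrow> 'y pmf) \<Rightarrow> ('x \<times> 'y) pmf" where
  "joint_pmf P V = bind_pmf P (\<lambda>x. map_pmf (Pair x) (V x))"

definition mutual_info :: "'x pmf \<Rightarrow> ('x \<Rightarrow> 'y pmf) \<Rightarrow> real" where
  "mutual_info P V =
     prob_space.mutual_information (measure_pmf (joint_pmf P V)) 2
       (count_space UNIV) (count_space UNIV) fst snd"

text \<open>The set of mutual informations is bounded above and, by compactness, the supremum is a
  maximum.\<close>

definition capacity :: "('x::finite \<Rightarrow> 'y::finite pmf) \<Rightarrow> real" where
  "capacity V = (SUP P. mutual_info P V)"

definition info_density :: "('x \<Rightarrow> 'y pmf) \<Rightarrow> 'x pmf \<Rightarrow> 'x \<Rightarrow> 'y \<Rightarrow> real" where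
  "info_density W P x y = log 2 (pmf (W x) y / pmf (bind_pmf P W) y)"

text \<open>The infimum ranges over a nonempty compact set of input distributions and is attained.\<close>

definition dispersion :: "('x::finite \<Rightarrow> 'y::finite pmf) \<Rightarrow> real" where
  "dispersion W =
     (INF P\<in>{P. mutual_info P W = capacity W}.
        measure_pmf.expectation P (\<lambda>x. measure_pmf.variance (W x) (info_density W P x)))"

definition output_symmetric :: "('x \<Rightarrow> 'y pmf) \<Rightarrow> bool" where
  "output_symmetric W \<longleftrightarrow>
     (\<exists>\<B>. partition_on UNIV \<B> \<and>
       (\<forall>B\<in>\<B>.
          (\<forall>x x'. \<exists>\<pi>. \<pi> permutes B \<and> (\<forall>y\<in>B. pmf (W x') y = pmf (W x) (\<pi> y))) \<and>
          (\<forall>y\<in>B. \<forall>y'\<in>B. \<exists>\<pi>. \<pi> permutes UNIV \<and> (\<forall>x. pmf (W x) y' = pmf (W (\<pi> x)) y))))"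

text \<open>Divergences are extended reals, with the conventions \<open>0 log (0/w) = 0\<close> and
  \<open>v log (v/0) = \<infinity>\<close> for \<open>v > 0\<close>; a letter of \<open>P\<close>-probability 0 contributes 0.\<close>

definition kl_term :: "real \<Rightarrow> real \<Rightarrow> ereal" where
  "kl_term v w = (if v = 0 then 0 else if w = 0 then \<infinity> else ereal (v * log 2 (v / w)))"

definition cond_div :: "('x::finite \<Rightarrow> 'y::finite pmf) \<Rightarrow> ('x \<Rightarrow> 'y pmf) \<Rightarrow> 'x pmf \<Rightarrow> ereal" where
  "cond_div V W P =
     (\<Sum>x\<in>UNIV. ereal (pmf P x) * (\<Sum>y\<in>UNIV. kl_term (pmf (V x) y) (pmf (W x) y)))"

definition exp2 :: "ereal \<Rightarrow> ereal" where
  "exp2 a = (if a = -\<infinity> then 0 else if a = \<infinity> then \<infinity> else ereal (2 powr real_of_ereal a))"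

text \<open>The type of a sequence; only meaningful for a nonempty list.\<close>

definition seq_type :: "'x list \<Rightarrow> 'x pmf" where
  "seq_type xs = pmf_of_multiset (mset xs)"

definition seq_prob :: "('x \<Rightarrow> 'y pmf) \<Rightarrow> 'x list \<Rightarrow> 'y list \<Rightarrow> real" where
  "seq_prob V xs ys = (\<Prod>i<length xs. pmf (V (xs ! i)) (ys ! i))"

definition seq_prob_set :: "('x \<Rightarrow> 'y pmf) \<Rightarrow> 'x list \<Rightarrow> 'y list set \<Rightarrow> real" where
  "seq_prob_set V xs A = (\<Sum>ys\<in>A. seq_prob V xs ys)"


section \<open>Parameters\<close>

text \<open>\<open>M\<^sub>n = exp (n C - n\<^sup>1\<^sup>-\<^sup>t)\<close> is a real number; the message set consists of
  the positive integers up to it.\<close>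

definition num_messages :: "('x::finite \<Rightarrow> 'y::finite pmf) \<Rightarrow> real \<Rightarrow> nat \<Rightarrow> real" where
  "num_messages W t n = 2 powr (real n * capacity W - real n powr (1 - t))"

definition message_set :: "('x::finite \<Rightarrow> 'y::finite pmf) \<Rightarrow> real \<Rightarrow> nat \<Rightarrow> nat set" where
  "message_set W t n = {m. 1 \<le> m \<and> real m \<le> num_messages W t n}"

definition rate :: "('x::finite \<Rightarrow> 'y::finite pmf) \<Rightarrow> real \<Rightarrow> nat \<Rightarrow> real" where
  "rate W t n = log 2 (num_messages W t n) / real n"

definition S_star :: "real \<Rightarrow> (nat \<Rightarrow> nat) \<Rightarrow> nat \<Rightarrow> real" where
  "S_star t S n =
     (let \<zeta> = (1/2) * (1/3 - t)
      in min (real (S n)) (2 powr (real n powr ((1 - 3 * (t + \<zeta>)) / 4))))"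

definition delta ::
  "('x::finite \<Rightarrow> 'y::finite pmf) \<Rightarrow> real \<Rightarrow> nat \<Rightarrow> (nat \<Rightarrow> nat) \<Rightarrow> nat \<Rightarrow> real" where
  "delta W t T S n = (real T - 1) * rate W t n / (S_star t S n + real T - 1)"

definition is_V_star ::
  "('x::finite \<Rightarrow> 'y::finite pmf) \<Rightarrow> real \<Rightarrow> nat \<Rightarrow> (nat \<Rightarrow> nat) \<Rightarrow> nat \<Rightarrow> ('x \<Rightarrow> 'y pmf) \<Rightarrow> bool" where
  "is_V_star W t T S n =
     is_arg_min (\<lambda>V. SUP P. cond_div V W P)
                (\<lambda>V. capacity V \<le> rate W t n - 2 * delta W t T S n)"


section \<open>Streaming codes\<close>

text \<open>Message vectors are lists over the message set \<open>G\<close>, so \<open>G\<^sub>k\<close> is \<open>g ! (k - 1)\<close> and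
  \<open>G\<^sup>j\<close> is \<open>take j g\<close>. The block inputs and outputs are concatenated into flat lists.\<close>

definition words :: "'a set \<Rightarrow> nat \<Rightarrow> 'a list set" where
  "words G l = {g. set g \<subseteq> G \<and> length g = l}"

definition transmitted :: "nat \<Rightarrow> nat \<Rightarrow> (nat \<Rightarrow> nat list \<Rightarrow> 'x list) \<Rightarrow> nat list \<Rightarrow> 'x list" where
  "transmitted S T \<phi> g = concat (map (\<lambda>k. \<phi> k (take (min k S) g)) [1..<S + T])"

text \<open>\<open>error_prob V G S T n \<phi> k d\<close> is the probability, with uniform independent messages and
  memoryless channel \<open>V\<close>, that \<open>G\<^sub>k\<close> differs from the value of \<open>d\<close> at the true previous
  messages \<open>G\<^sup>k\<^sup>-\<^sup>1\<close> and the outputs of blocks \<open>1, ..., k + T - 1\<close>.\<close>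

definition error_prob ::
  "('x \<Rightarrow> 'y::finite pmf) \<Rightarrow> nat set \<Rightarrow> nat \<Rightarrow> nat \<Rightarrow> nat \<Rightarrow> (nat \<Rightarrow> nat list \<Rightarrow> 'x list) \<Rightarrow> nat
     \<Rightarrow> (nat list \<Rightarrow> 'y list \<Rightarrow> nat) \<Rightarrow> real" where
  "error_prob V G S T n \<phi> k d =
     (\<Sum>g\<in>words G S.
        seq_prob_set V (transmitted S T \<phi> g)
          {ys \<in> words UNIV ((S + T - 1) * n).
             d (take (k - 1) g) (take ((k + T - 1) * n) ys) \<noteq> g ! (k - 1)})
     / real (card (words G S))"

definition decoders :: "nat set \<Rightarrow> nat \<Rightarrow> nat \<Rightarrow> (nat list \<Rightarrow> 'y list \<Rightarrow> nat) set" where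
  "decoders G j l = {d. \<forall>g\<in>words G j. \<forall>ys\<in>words UNIV l. d g ys \<in> G}"

text \<open>A decoder for message \<open>k\<close> that sees only the outputs of blocks \<open>k, ..., k + T - 1\<close>.\<close>

definition latest ::
  "nat \<Rightarrow> nat \<Rightarrow> (nat list \<Rightarrow> 'y list \<Rightarrow> nat) \<Rightarrow> nat list \<Rightarrow> 'y list \<Rightarrow> nat" where
  "latest n k d = (\<lambda>g ys. d g (drop ((k - 1) * n) ys))"

definition encoder :: "nat set \<Rightarrow> nat \<Rightarrow> nat \<Rightarrow> nat \<Rightarrow> (nat \<Rightarrow> nat list \<Rightarrow> 'x list) \<Rightarrow> bool" where
  "encoder G S T n \<phi> \<longleftrightarrow>
     (\<forall>k\<in>{1..S + T - 1}. \<forall>g\<in>words G (min k S). \<phi> k g \<in> words UNIV n)"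

definition optimal_decoder ::
  "('x \<Rightarrow> 'y::finite pmf) \<Rightarrow> nat set \<Rightarrow> nat \<Rightarrow> nat \<Rightarrow> nat \<Rightarrow> (nat \<Rightarrow> nat list \<Rightarrow> 'x list)
     \<Rightarrow> (nat \<Rightarrow> nat list \<Rightarrow> 'y list \<Rightarrow> nat) \<Rightarrow> bool" where
  "optimal_decoder W G S T n \<phi> \<psi> \<longleftrightarrow>
     (\<forall>k\<in>{1..S}.
        \<psi> k \<in> decoders G (k - 1) (T * n) \<and>
        (\<forall>f\<in>decoders G (k - 1) ((k + T - 1) * n).
           error_prob W G S T n \<phi> k (latest n k (\<psi> k)) \<le> error_prob W G S T n \<phi> k f))"


section \<open>Mutual information as a finite sum\<close>

lemma pmf_joint_pmf:
  "pmf (joint_pmf (P :: 'x::finite pmf) V) (x, y) = pmf P x * pmf (V x) y"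
proof -
  have "pmf (map_pmf (Pair z) (V z)) (x, y) = (if z = x then pmf (V x) y else 0)" for z
  proof (cases "z = x")
    case True
    then show ?thesis
      by (simp add: pmf_map_inj' inj_def)
  next
    case False
    then show ?thesis
      by (simp add: pmf_eq_0_set_pmf image_iff)
  qed
  then have "pmf P z * pmf (map_pmf (Pair z) (V z)) (x, y) =
      (if z = x then pmf P x * pmf (V x) y else 0)" for z
    by (simp only: mult_zero_right split: if_split) simp
  then show ?thesis
    by (simp add: joint_pmf_def pmf_bind integral_measure_pmf[of UNIV] del: pmf_map_inj')
qed

lemma map_fst_joint_pmf: "map_pmf fst (joint_pmf P V) = P"
  by (simp add: joint_pmf_def map_bind_pmf map_pmf_comp bind_return_pmf' o_def)

lemma map_snd_joint_pmf: "map_pmf snd (joint_pmf P V) = bind_pmf P V"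
  by (simp add: joint_pmf_def map_bind_pmf map_pmf_comp o_def)

lemma mutual_info_eq:
  fixes P :: "'x::finite pmf" and V :: "'x \<Rightarrow> 'y::finite pmf"
  shows "mutual_info P V =
    (\<Sum>x\<in>UNIV. pmf P x * (\<Sum>y\<in>UNIV. pmf (V x) y * info_density V P x y))"
proof -
  let ?J = "joint_pmf P V"
  let ?Q = "bind_pmf P V"
  have count: "count_space UNIV \<Otimes>\<^sub>M count_space UNIV = (count_space UNIV :: ('x \<times> 'y) measure)"
    by (simp add: pair_measure_count_space)
  have dP: "measure_pmf P = density (count_space UNIV) (\<lambda>x. ennreal (pmf P x))"
    and dQ: "measure_pmf ?Q = density (count_space UNIV) (\<lambda>y. ennreal (pmf ?Q y))"
    and dJ: "measure_pmf ?J = density (count_space UNIV) (\<lambda>z. ennreal (pmf ?J z))"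
    by (rule measure_pmf_eq_density)+
  have fst: "distr (measure_pmf ?J) (count_space UNIV) fst = measure_pmf P"
    by (metis map_fst_joint_pmf map_pmf_rep_eq)
  have snd: "distr (measure_pmf ?J) (count_space UNIV) snd = measure_pmf ?Q"
    by (metis map_snd_joint_pmf map_pmf_rep_eq)
  interpret J: information_space "measure_pmf ?J" 2
    by unfold_locales simp
  have "mutual_info P V = (\<integral>z. pmf ?J z * log 2 (pmf ?J z / (pmf P (fst z) * pmf ?Q (snd z)))
      \<partial>(count_space UNIV \<Otimes>\<^sub>M count_space UNIV))"
    unfolding mutual_info_def
  proof (subst J.mutual_information_distr[where Px = "pmf P" and Py = "pmf ?Q" and Pxy = "pmf ?J"])
    show "distributed (measure_pmf ?J) (count_space UNIV) fst (\<lambda>x. ennreal (pmf P x))"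
      using fst dP by (auto simp: distributed_def)
    show "distributed (measure_pmf ?J) (count_space UNIV) snd (\<lambda>x. ennreal (pmf ?Q x))"
      using snd dQ by (auto simp: distributed_def)
    have "distr (measure_pmf ?J) (count_space UNIV) (\<lambda>x. x) = measure_pmf ?J"
      by (metis map_pmf_ident map_pmf_rep_eq)
    then show "distributed (measure_pmf ?J) (count_space UNIV \<Otimes>\<^sub>M count_space UNIV)
        (\<lambda>x. (fst x, snd x)) (\<lambda>z. ennreal (pmf ?J z))"
      unfolding count using dJ by (auto simp: distributed_def)
  qed (auto simp: split_beta intro: sigma_finite_measure_count_space_finite)
  also have "\<dots> = (\<Sum>z\<in>UNIV \<times> UNIV.
      pmf ?J z * log 2 (pmf ?J z / (pmf P (fst z) * pmf ?Q (snd z))))"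
    unfolding count by (simp add: lebesgue_integral_count_space_finite)
  also have "\<dots> = (\<Sum>x\<in>UNIV. \<Sum>y\<in>UNIV.
      pmf ?J (x, y) * log 2 (pmf ?J (x, y) / (pmf P x * pmf ?Q y)))"
    unfolding sum.cartesian_product by (intro sum.cong refl) (simp split: prod.split)
  also have "\<dots> = (\<Sum>x\<in>UNIV. pmf P x * (\<Sum>y\<in>UNIV. pmf (V x) y * info_density V P x y))"
    unfolding sum_distrib_left
    by (intro sum.cong refl) (simp add: pmf_joint_pmf info_density_def)
  finally show ?thesis .
qed

end

theory Submission
  imports Defs "HOL-Real_Asymp.Real_Asymp"
begin

text \<open>Tilting each row of \<open>W\<close> against its information density, by an amount of order \<open>n powr (- t)\<close>,
  lowers the capacity by more than \<open>n powr (- t) + 2 \<delta>\<close> because \<open>\<nu> > 0\<close>, at a divergence cost of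
  order only \<open>n powr (- 2 t)\<close>. Hence the minimizer \<open>V\<close> satisfies \<open>D(V(x) || W(x)) = O(n powr (- 2 t))\<close>
  for every \<open>x\<close>, and a Hellinger bound turns this into \<open>\<bar>ln (V / W)\<bar> = O(n powr (- t))\<close> pointwise.
  With log-likelihood ratios this small, Chernoff's method bounds the \<open>V\<close>-probability that their sum
  exceeds its mean by \<open>T n \<eta>\<close>, where \<open>\<eta> = n powr (- 2 t - (1 - 3 t) / 4)\<close>, by
  \<open>exp (- k n powr ((1 - t) / 2))\<close>. This is eventually below \<open>\<delta>' / 4\<close>, since the truncation in \<open>S_star\<close>
  keeps \<open>\<delta>'\<close> above \<open>c 2 powr (- 2 n powr ((1 - 3 t) / 8))\<close>. Off that event \<open>W\<close> dominates
  \<open>2 powr (- T n (D + \<eta>)) V\<close>, and the lemma follows by a change of measure.\<close>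

section \<open>Divergence of finite distributions and the Hellinger bound\<close>

text \<open>Meaningful only if \<open>set_pmf p \<subseteq> set_pmf q\<close>: otherwise \<open>x / 0 = 0\<close> makes the infinite terms vanish.\<close>

definition kl_div :: "'a::finite pmf \<Rightarrow> 'a pmf \<Rightarrow> real" where
  "kl_div p q = (\<Sum>y\<in>UNIV. pmf p y * log 2 (pmf p y / pmf q y))"

text \<open>Apply \<open>ln x \<le> x - 1\<close> at \<open>x = sqrt w / sqrt v\<close>; adding
  \<open>- v + w\<close> then completes the square. The correction \<open>- v + w\<close> cancels
  once the terms are summed over two distributions.\<close>

lemma hellinger_term_le:
  fixes v w :: real
  assumes "v \<ge> 0" "w \<ge> 0" "w = 0 \<Longrightarrow> v = 0"
  shows "(sqrt v - sqrt w)\<^sup>2 \<le> ln 2 * (v * log 2 (v / w)) - v + w"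
proof (cases "v = 0")
  case True
  then show ?thesis using assms by simp
next
  case False
  then have pos: "v > 0" "w > 0" using assms by force+
  have "ln (sqrt w / sqrt v) \<le> sqrt w / sqrt v - 1"
    using pos by (intro ln_le_minus_one) simp
  moreover have "ln (sqrt w / sqrt v) = - ln (v / w) / 2"
    using pos by (simp add: ln_div ln_sqrt field_simps)
  ultimately have "v * ln (v / w) \<ge> 2 * v - 2 * v * (sqrt w / sqrt v)"
    using pos mult_left_mono[of "2 - 2 * (sqrt w / sqrt v)" "ln (v / w)" v]
    by (simp add: right_diff_distrib mult_ac)
  moreover have "v * (sqrt w / sqrt v) = sqrt v * sqrt w"
    using pos by (simp add: field_simps)
  moreover have "(sqrt v - sqrt w)\<^sup>2 = v + w - 2 * (sqrt v * sqrt w)"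
    using pos by (simp add: power2_diff)
  moreover have "ln 2 * (v * log 2 (v / w)) = v * ln (v / w)"
    by (simp add: log_def)
  ultimately show ?thesis by linarith
qed

lemma sum_pmf_UNIV: "(\<Sum>y\<in>UNIV. pmf (p :: 'a::finite pmf) y) = 1"
  by (rule sum_pmf_eq_1) auto

lemma hellinger_le_kl_div:
  fixes p q :: "'a::finite pmf"
  assumes "set_pmf p \<subseteq> set_pmf q"
  shows "(\<Sum>y\<in>UNIV. (sqrt (pmf p y) - sqrt (pmf q y))\<^sup>2) \<le> ln 2 * kl_div p q"
proof -
  have "(\<Sum>y\<in>UNIV. (sqrt (pmf p y) - sqrt (pmf q y))\<^sup>2)
      \<le> (\<Sum>y\<in>UNIV. ln 2 * (pmf p y * log 2 (pmf p y / pmf q y)) - pmf p y + pmf q y)"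
    using assms by (intro sum_mono hellinger_term_le) (auto simp: set_pmf_eq)
  also have "\<dots> = ln 2 * kl_div p q"
    by (simp add: sum.distrib sum_subtractf sum_pmf_UNIV kl_div_def sum_distrib_left)
  finally show ?thesis .
qed

lemma kl_div_nonneg: "set_pmf p \<subseteq> set_pmf q \<Longrightarrow> kl_div p q \<ge> 0"
  using order_trans[OF sum_nonneg hellinger_le_kl_div[of p q]] by (simp add: zero_le_mult_iff)

lemma sqrt_pmf_diff_le_kl_div:
  assumes "set_pmf p \<subseteq> set_pmf q"
  shows "(sqrt (pmf p y) - sqrt (pmf q y))\<^sup>2 \<le> ln 2 * kl_div p q"
  by (rule order_trans[OF member_le_sum hellinger_le_kl_div[OF assms]]) auto

text \<open>Factor the difference as \<open>(sqrt p - sqrt q) * (sqrt p + sqrt q)\<close>: the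
  Hellinger bound controls the first factor, and the second is at most 2. A divergence of order
  \<open>n powr (- 2 * t)\<close> thus gives pointwise closeness of order
  \<open>n powr (- t)\<close>.\<close>

lemma abs_pmf_diff_le_kl_div:
  assumes "set_pmf p \<subseteq> set_pmf q"
  shows "\<bar>pmf p y - pmf q y\<bar> \<le> 2 * sqrt (kl_div p q)"
proof -
  have "ln 2 \<le> (1::real)" using ln_le_minus_one[of 2] by simp
  then have "ln 2 * kl_div p q \<le> kl_div p q"
    using kl_div_nonneg[OF assms] mult_right_mono[of "ln 2" 1 "kl_div p q"] by simp
  then have *: "\<bar>sqrt (pmf p y) - sqrt (pmf q y)\<bar> \<le> sqrt (kl_div p q)"
    using sqrt_pmf_diff_le_kl_div[OF assms, of y] by (intro real_le_rsqrt) auto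
  have "pmf p y - pmf q y = (sqrt (pmf p y) - sqrt (pmf q y)) * (sqrt (pmf p y) + sqrt (pmf q y))"
    by (simp add: algebra_simps)
  then have "\<bar>pmf p y - pmf q y\<bar> =
      \<bar>sqrt (pmf p y) - sqrt (pmf q y)\<bar> * (sqrt (pmf p y) + sqrt (pmf q y))"
    by (simp add: abs_mult)
  also have "\<dots> \<le> sqrt (kl_div p q) * (1 + 1)"
    by (intro mult_mono * add_mono) (auto simp: pmf_le_1 kl_div_nonneg[OF assms])
  finally show ?thesis by simp
qed

section \<open>Conditional divergence: from extended reals to reals\<close>

lemma sum_kl_term:
  fixes p q :: "'a::finite pmf"
  shows "(\<Sum>y\<in>UNIV. kl_term (pmf p y) (pmf q y)) =
    (if set_pmf p \<subseteq> set_pmf q then ereal (kl_div p q) else \<infinity>)"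
proof (cases "set_pmf p \<subseteq> set_pmf q")
  case True
  then have "kl_term (pmf p y) (pmf q y) = ereal (pmf p y * log 2 (pmf p y / pmf q y))" for y
    by (auto simp: kl_term_def set_pmf_eq)
  then show ?thesis using True by (simp add: kl_div_def)
next
  case False
  then obtain y where "y \<in> set_pmf p" "y \<notin> set_pmf q" by auto
  then have "kl_term (pmf p y) (pmf q y) = \<infinity>" by (simp add: kl_term_def set_pmf_eq)
  then show ?thesis using False by (auto simp: sum_Pinfty)
qed

lemma cond_div_finite:
  assumes "\<And>x. x \<in> set_pmf P \<Longrightarrow> set_pmf (V x) \<subseteq> set_pmf (W x)"
  shows "cond_div V W P = ereal (\<Sum>x\<in>UNIV. pmf P x * kl_div (V x) (W x))"
proof -
  \<comment> \<open>Outside the support of \<open>P\<close> the factor is 0, and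
    \<open>0 * \<infinity> = 0\<close> in \<open>ereal\<close>; so absolute continuity matters only
    on letters of positive probability.\<close>
  have "ereal (pmf P x) * (\<Sum>y\<in>UNIV. kl_term (pmf (V x) y) (pmf (W x) y)) =
      ereal (pmf P x * kl_div (V x) (W x))" for x
    using assms[of x] by (cases "x \<in> set_pmf P") (auto simp: sum_kl_term set_pmf_eq)
  then show ?thesis by (simp add: cond_div_def)
qed

lemma cond_div_infinite:
  assumes "x \<in> set_pmf P" "\<not> set_pmf (V x) \<subseteq> set_pmf (W x)"
  shows "cond_div V W P = \<infinity>"
proof -
  have "ereal (pmf P x) * (\<Sum>y\<in>UNIV. kl_term (pmf (V x) y) (pmf (W x) y)) = \<infinity>"
    using assms by (simp add: sum_kl_term pmf_positive set_pmf_eq)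
  then show ?thesis by (auto simp: cond_div_def sum_Pinfty)
qed

text \<open>Point masses extract a single row, which later turns a bound on the supremum over all
  \<open>P\<close> into a bound for every input letter.\<close>

lemma cond_div_return_pmf:
  "cond_div V W (return_pmf x) =
    (if set_pmf (V x) \<subseteq> set_pmf (W x) then ereal (kl_div (V x) (W x)) else \<infinity>)"
proof (cases "set_pmf (V x) \<subseteq> set_pmf (W x)")
  case True
  then have "cond_div V W (return_pmf x) =
      ereal (\<Sum>z\<in>UNIV. pmf (return_pmf x) z * kl_div (V z) (W z))"
    by (intro cond_div_finite) auto
  also have "(\<Sum>z\<in>UNIV. pmf (return_pmf x) z * kl_div (V z) (W z)) = kl_div (V x) (W x)"
    by (subst sum.remove[of _ x]) (auto simp: pmf_return intro!: sum.neutral)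
  finally show ?thesis using True by simp
next
  case False
  then show ?thesis by (simp add: cond_div_infinite)
qed

section \<open>Types, and sums over words\<close>

lemma set_pmf_seq_type: "xs \<noteq> [] \<Longrightarrow> set_pmf (seq_type xs) = set xs"
  by (simp add: seq_type_def)

text \<open>Length times type is the letter count. This identifies the mean log-likelihood ratio
  along \<open>xs\<close> with the length times the conditional divergence.\<close>

lemma sum_seq_type:
  fixes xs :: "'x::finite list"
  assumes "xs \<noteq> []"
  shows "real (length xs) * (\<Sum>x\<in>UNIV. pmf (seq_type xs) x * f x) = (\<Sum>i<length xs. f (xs ! i))"
proof -
  have "real (length xs) * (\<Sum>x\<in>UNIV. pmf (seq_type xs) x * f x) =
      (\<Sum>x\<in>UNIV. real (count (mset xs) x) * f x)"
    using assms by (simp add: seq_type_def sum_distrib_left)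
  also have "\<dots> = sum_list (map f xs)"
  proof (induction xs)
    case (Cons a xs)
    have "(\<Sum>x\<in>UNIV. real (count (mset (a # xs)) x) * f x) =
        (\<Sum>x\<in>UNIV. real (count (mset xs) x) * f x + (if x = a then f x else 0))"
      by (intro sum.cong) (auto simp: algebra_simps)
    then show ?case using Cons by (simp add: sum.distrib)
  qed simp
  also have "\<dots> = (\<Sum>i<length xs. f (xs ! i))"
    by (simp add: sum_list_sum_nth atLeast0LessThan)
  finally show ?thesis .
qed

lemma finite_lists_length: "finite {ys :: 'a::finite list. length ys = l}"
  using finite_lists_length_eq[of "UNIV :: 'a set" l] by simp

text \<open>This is the independence of the letters: an expectation of a product over positions
  factorizes.\<close>

lemma sum_prod_lists:
  fixes g :: "nat \<Rightarrow> 'a::finite \<Rightarrow> real"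
  shows "(\<Sum>ys | length ys = l. \<Prod>i<l. g i (ys ! i)) = (\<Prod>i<l. \<Sum>y\<in>UNIV. g i y)"
proof (induction l arbitrary: g)
  case (Suc l)
  have eq: "{ys :: 'a list. length ys = Suc l} = (\<lambda>(y, ys). y # ys) ` (UNIV \<times> {ys. length ys = l})"
    by (auto simp: length_Suc_conv image_iff)
  have inj: "inj_on (\<lambda>(y, ys). y # ys) (UNIV \<times> {ys :: 'a list. length ys = l})"
    by (auto simp: inj_on_def)
  have "(\<Sum>ys | length ys = Suc l. \<Prod>i<Suc l. g i (ys ! i)) =
      (\<Sum>(y, ys)\<in>UNIV \<times> {ys. length ys = l}. g 0 y * (\<Prod>i<l. g (Suc i) (ys ! i)))"
    unfolding eq sum.reindex[OF inj]
    by (intro sum.cong) (auto simp: prod.lessThan_Suc_shift simp del: prod.lessThan_Suc)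
  also have "\<dots> = (\<Sum>y\<in>UNIV. \<Sum>ys | length ys = l. g 0 y * (\<Prod>i<l. g (Suc i) (ys ! i)))"
    by (simp add: sum.cartesian_product)
  also have "\<dots> = (\<Sum>y\<in>UNIV. g 0 y) * (\<Sum>ys | length ys = l. \<Prod>i<l. g (Suc i) (ys ! i))"
    by (simp add: sum_product)
  also have "\<dots> = (\<Prod>i<Suc l. \<Sum>y\<in>UNIV. g i y)"
    by (subst Suc.IH) (simp add: prod.lessThan_Suc_shift del: prod.lessThan_Suc)
  finally show ?case .
qed simp

section \<open>Chernoff bound for log-likelihood ratios\<close>

lemma exp_le_quadratic:
  fixes u :: real
  assumes "\<bar>u\<bar> \<le> 1"
  shows "exp u \<le> 1 + u + u\<^sup>2"
proof (cases "u \<ge> 0")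
  case True
  then show ?thesis using assms by (intro exp_bound) auto
next
  case False
  \<comment> \<open>For negative \<open>u\<close> the bound follows from
    \<open>(1 + x) * (1 - x + x\<^sup>2) = 1 + x ^ 3\<close>, which is at least 1, together with
    \<open>1 + x \<le> exp x\<close>.\<close>
  define x where "x = - u"
  have x: "0 < x" "x \<le> 1" using False assms by (auto simp: x_def)
  have "exp x * (1 - x + x\<^sup>2) \<ge> (1 + x) * (1 - x + x\<^sup>2)"
  proof (rule mult_right_mono)
    show "1 + x \<le> exp x" by simp
    show "0 \<le> 1 - x + x\<^sup>2" using x by simp
  qed
  moreover have "(1 + x) * (1 - x + x\<^sup>2) = 1 + x ^ 3"
    by (simp add: algebra_simps power2_eq_square power3_eq_cube)
  moreover have "x ^ 3 > 0" using x by simp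
  ultimately have "exp x * (1 - x + x\<^sup>2) \<ge> 1" by linarith
  then have "exp (- x) * (exp x * (1 - x + x\<^sup>2)) \<ge> exp (- x) * 1"
    by (intro mult_left_mono) auto
  moreover have "exp (- x) * (exp x * (1 - x + x\<^sup>2)) = 1 - x + x\<^sup>2"
    by (simp add: mult.assoc[symmetric] exp_add[symmetric])
  ultimately have "exp (- x) \<le> 1 - x + x\<^sup>2" by simp
  then show ?thesis by (simp add: x_def)
qed

text \<open>Expand \<open>exp (s * ln (p / q))\<close> to second order. The linear term averages to
  the divergence, converted from bits by \<open>ln 2\<close>, and the quadratic one is at most
  \<open>s\<^sup>2 * B\<^sup>2\<close>; then \<open>1 + z \<le> exp z\<close>.\<close>

lemma likelihood_ratio_mgf_le:
  fixes p q :: "'a::finite pmf"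
  assumes sub: "set_pmf p \<subseteq> set_pmf q"
    and B: "\<And>y. y \<in> set_pmf p \<Longrightarrow> \<bar>ln (pmf p y / pmf q y)\<bar> \<le> B"
    and s: "s \<ge> 0" "s * B \<le> 1"
  shows "(\<Sum>y\<in>UNIV. pmf p y * (pmf p y / pmf q y) powr s) \<le>
    exp (s * ln 2 * kl_div p q + s\<^sup>2 * B\<^sup>2)"
proof -
  let ?L = "\<lambda>y. ln (pmf p y / pmf q y)"
  have "pmf p y * (pmf p y / pmf q y) powr s \<le> pmf p y * (1 + s * ?L y + s\<^sup>2 * B\<^sup>2)" for y
  proof (cases "y \<in> set_pmf p")
    case True
    then have pos: "pmf p y > 0" "pmf q y > 0" using sub by (auto simp: pmf_positive)
    have "\<bar>s * ?L y\<bar> \<le> s * B" using B[OF True] s by (simp add: abs_mult mult_left_mono)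
    then have le: "\<bar>s * ?L y\<bar> \<le> 1" using s by linarith
    have "(pmf p y / pmf q y) powr s = exp (s * ?L y)" using pos by (simp add: powr_def)
    also have "\<dots> \<le> 1 + s * ?L y + (s * ?L y)\<^sup>2" by (rule exp_le_quadratic[OF le])
    also have "(s * ?L y)\<^sup>2 \<le> s\<^sup>2 * B\<^sup>2"
      using power_mono[OF B[OF True], of 2] by (simp add: power_mult_distrib mult_left_mono)
    finally show ?thesis by (intro mult_left_mono) auto
  qed (simp add: set_pmf_eq)
  then have "(\<Sum>y\<in>UNIV. pmf p y * (pmf p y / pmf q y) powr s) \<le>
      (\<Sum>y\<in>UNIV. pmf p y * (1 + s * ?L y + s\<^sup>2 * B\<^sup>2))"
    by (rule sum_mono)
  also have "\<dots> = (\<Sum>y\<in>UNIV. pmf p y * (1 + s\<^sup>2 * B\<^sup>2)) +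
      (\<Sum>y\<in>UNIV. s * ln 2 * (pmf p y * log 2 (pmf p y / pmf q y)))"
    unfolding sum.distrib[symmetric] by (intro sum.cong) (auto simp: log_def algebra_simps)
  also have "\<dots> = 1 + (s * ln 2 * kl_div p q + s\<^sup>2 * B\<^sup>2)"
    by (simp add: kl_div_def sum_distrib_left[symmetric] sum_distrib_right[symmetric] sum_pmf_UNIV)
  also have "\<dots> \<le> exp (s * ln 2 * kl_div p q + s\<^sup>2 * B\<^sup>2)" by (rule exp_ge_add_one_self)
  finally show ?thesis .
qed

lemma seq_prob_nonneg: "seq_prob V xs ys \<ge> 0"
  by (simp add: seq_prob_def prod_nonneg)

lemma seq_prob_set_nonneg: "seq_prob_set V xs A \<ge> 0"
  by (simp add: seq_prob_set_def sum_nonneg seq_prob_nonneg)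

text \<open>Markov's inequality for the \<open>s\<close>-th power of the likelihood ratio under
  \<open>V\<close>. The divergences in the moment bound cancel the part \<open>D\<close> of the
  threshold, so only the excess \<open>e\<close> and the quadratic error remain.\<close>

lemma likelihood_ratio_tail:
  fixes V W :: "'x::finite \<Rightarrow> 'y::finite pmf"
  assumes ne: "xs \<noteq> []"
    and sub: "\<And>x. x \<in> set xs \<Longrightarrow> set_pmf (V x) \<subseteq> set_pmf (W x)"
    and B: "\<And>x y. x \<in> set xs \<Longrightarrow> y \<in> set_pmf (V x) \<Longrightarrow> \<bar>ln (pmf (V x) y / pmf (W x) y)\<bar> \<le> B"
    and s: "s \<ge> 0" "s * B \<le> 1"
    and D: "D = (\<Sum>x\<in>UNIV. pmf (seq_type xs) x * kl_div (V x) (W x))"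
  shows "seq_prob_set V xs {ys. length ys = length xs \<and>
      2 powr (real (length xs) * (D + e)) * seq_prob W xs ys < seq_prob V xs ys}
    \<le> exp (real (length xs) * (s\<^sup>2 * B\<^sup>2 - s * ln 2 * e))"
    (is "seq_prob_set V xs ?U \<le> _")
proof -
  let ?l = "length xs"
  let ?c = "real ?l * (D + e)"
  let ?g = "\<lambda>i y. pmf (V (xs ! i)) y * (pmf (V (xs ! i)) y / pmf (W (xs ! i)) y) powr s"
  \<comment> \<open>Markov's inequality in pointwise form: on the event, the ratio divided by its
    threshold is at least 1, hence so is its \<open>s\<close>-th power.\<close>
  have pw: "seq_prob V xs ys \<le> 2 powr (- (s * ?c)) * (\<Prod>i<?l. ?g i (ys ! i))" if "ys \<in> ?U" for ys
  proof -
    have gt: "2 powr ?c * seq_prob W xs ys < seq_prob V xs ys" using that by simp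
    \<comment> \<open>The strict inequality makes the \<open>V\<close>-probability positive, hence
      every \<open>V\<close>-letter, and by \<open>sub\<close> every \<open>W\<close>-letter; no
      quotient below is a division by zero.\<close>
    have Vpos: "seq_prob V xs ys > 0"
      using gt seq_prob_nonneg[of W xs ys]
      by (meson le_less_trans mult_nonneg_nonneg powr_ge_zero)
    have vpos: "pmf (V (xs ! i)) (ys ! i) > 0" if "i < ?l" for i
      using that Vpos by (auto simp: seq_prob_def less_le prod_zero_iff)
    have wpos: "pmf (W (xs ! i)) (ys ! i) > 0" if "i < ?l" for i
      using vpos[OF that] sub[of "xs ! i"] that by (force simp: pmf_positive_iff)
    have Wpos: "seq_prob W xs ys > 0"
      unfolding seq_prob_def using wpos by (intro prod_pos) auto
    have "(\<Prod>i<?l. ?g i (ys ! i)) =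
        seq_prob V xs ys * (\<Prod>i<?l. (pmf (V (xs ! i)) (ys ! i) / pmf (W (xs ! i)) (ys ! i)) powr s)"
      by (simp add: prod.distrib seq_prob_def)
    also have "(\<Prod>i<?l. (pmf (V (xs ! i)) (ys ! i) / pmf (W (xs ! i)) (ys ! i)) powr s) =
        (seq_prob V xs ys / seq_prob W xs ys) powr s"
      unfolding seq_prob_def prod_dividef[symmetric] by (rule prod_powr_distrib[symmetric])
    finally have eq: "(\<Prod>i<?l. ?g i (ys ! i)) =
        seq_prob V xs ys * (seq_prob V xs ys / seq_prob W xs ys) powr s" .
    have "2 powr ?c \<le> seq_prob V xs ys / seq_prob W xs ys"
      using gt Wpos by (simp add: field_simps)
    then have "(2 powr ?c) powr s \<le> (seq_prob V xs ys / seq_prob W xs ys) powr s"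
      using s by (intro powr_mono2) auto
    then have "2 powr (s * ?c) \<le> (seq_prob V xs ys / seq_prob W xs ys) powr s"
      by (simp add: powr_powr mult.commute)
    then have "2 powr (- (s * ?c)) * (seq_prob V xs ys * 2 powr (s * ?c)) \<le>
        2 powr (- (s * ?c)) * (seq_prob V xs ys * (seq_prob V xs ys / seq_prob W xs ys) powr s)"
      using Vpos by (intro mult_left_mono) auto
    moreover have "2 powr (- (s * ?c)) * (seq_prob V xs ys * 2 powr (s * ?c)) = seq_prob V xs ys"
      by (simp add: mult.left_commute[of "_ powr _"] powr_add[symmetric])
    ultimately show ?thesis unfolding eq by simp
  qed
  have gnn: "0 \<le> (\<Prod>i<?l. ?g i (ys ! i))" for ys by (intro prod_nonneg) auto
  have "seq_prob_set V xs ?U \<le> (\<Sum>ys\<in>?U. 2 powr (- (s * ?c)) * (\<Prod>i<?l. ?g i (ys ! i)))"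
    unfolding seq_prob_set_def by (intro sum_mono pw)
  \<comment> \<open>Passing from the event to all words makes the sum factorize.\<close>
  also have "\<dots> \<le> (\<Sum>ys | length ys = ?l. 2 powr (- (s * ?c)) * (\<Prod>i<?l. ?g i (ys ! i)))"
    using gnn by (intro sum_mono2) (auto simp: finite_lists_length)
  also have "\<dots> = 2 powr (- (s * ?c)) * (\<Prod>i<?l. \<Sum>y\<in>UNIV. ?g i y)"
    by (simp only: sum_distrib_left[symmetric] sum_prod_lists[where g = ?g])
  also have "\<dots> \<le> 2 powr (- (s * ?c)) *
      (\<Prod>i<?l. exp (s * ln 2 * kl_div (V (xs ! i)) (W (xs ! i)) + s\<^sup>2 * B\<^sup>2))"
    using sub B s by (intro mult_left_mono prod_mono conjI likelihood_ratio_mgf_le sum_nonneg) auto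
  also have "\<dots> = exp (- (s * ?c) * ln 2 +
      (\<Sum>i<?l. s * ln 2 * kl_div (V (xs ! i)) (W (xs ! i)) + s\<^sup>2 * B\<^sup>2))"
    by (simp only: exp_add[of "- (s * ?c) * ln 2"] exp_sum finite_lessThan)
      (simp add: powr_def)
  also have "(\<Sum>i<?l. s * ln 2 * kl_div (V (xs ! i)) (W (xs ! i)) + s\<^sup>2 * B\<^sup>2) =
      s * ln 2 * (real ?l * D) + real ?l * (s\<^sup>2 * B\<^sup>2)"
    unfolding D sum_seq_type[OF ne, where f = "\<lambda>x. kl_div (V x) (W x)"]
    by (simp add: sum.distrib sum_distrib_left)
  finally show ?thesis by (simp add: algebra_simps)
qed

section \<open>Change of measure\<close>

lemma seq_prob_set_mono_ratio:
  assumes "finite A" "\<And>ys. ys \<in> A \<Longrightarrow> seq_prob V xs ys \<le> c * seq_prob W xs ys"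
  shows "seq_prob_set V xs A \<le> c * seq_prob_set W xs A"
  unfolding seq_prob_set_def sum_distrib_left by (intro sum_mono assms)

text \<open>Of the \<open>V\<close>-mass \<open>d / 2\<close> of \<open>A\<close>, at most
  \<open>d / 4\<close> lies where the likelihood ratio is too large. On the remainder
  \<open>V\<close> is dominated by \<open>2 powr c\<close> times \<open>W\<close>.\<close>

lemma change_of_measure:
  fixes V W :: "'x::finite \<Rightarrow> 'y::finite pmf"
  assumes A: "A \<subseteq> {ys. length ys = length xs}"
    and tail: "seq_prob_set V xs {ys. length ys = length xs \<and>
      2 powr c * seq_prob W xs ys < seq_prob V xs ys} \<le> d / 4" (is "seq_prob_set V xs ?U \<le> _")
    and ge: "seq_prob_set V xs A \<ge> d / 2"
  shows "seq_prob_set W xs A \<ge> d / 4 * 2 powr (- c)"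
proof -
  have fin: "finite A" using A finite_lists_length finite_subset by blast
  have "seq_prob_set V xs A = seq_prob_set V xs (A \<inter> ?U) + seq_prob_set V xs (A - ?U)"
    unfolding seq_prob_set_def by (rule sum.Int_Diff[OF fin])
  moreover have "seq_prob_set V xs (A \<inter> ?U) \<le> seq_prob_set V xs ?U"
    unfolding seq_prob_set_def
    by (intro sum_mono2) (auto simp: seq_prob_nonneg finite_lists_length)
  moreover have "seq_prob_set V xs (A - ?U) \<le> 2 powr c * seq_prob_set W xs (A - ?U)"
    using A fin by (intro seq_prob_set_mono_ratio) force+
  moreover have "seq_prob_set W xs (A - ?U) \<le> seq_prob_set W xs A"
    unfolding seq_prob_set_def by (intro sum_mono2) (auto simp: seq_prob_nonneg fin)
  then have "2 powr c * seq_prob_set W xs (A - ?U) \<le> 2 powr c * seq_prob_set W xs A"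
    by (intro mult_left_mono) auto
  ultimately have "d / 4 \<le> 2 powr c * seq_prob_set W xs A" using tail ge by linarith
  then show ?thesis by (simp add: powr_minus field_simps)
qed

lemma seq_prob_le_of_ratio_le:
  assumes "\<And>x y. x \<in> set xs \<Longrightarrow> pmf (V x) y \<le> 2 powr b * pmf (W x) y"
  shows "seq_prob V xs ys \<le> 2 powr (real (length xs) * b) * seq_prob W xs ys"
proof -
  have "seq_prob V xs ys \<le> (\<Prod>i<length xs. 2 powr b * pmf (W (xs ! i)) (ys ! i))"
    unfolding seq_prob_def using assms by (intro prod_mono) auto
  also have "\<dots> = 2 powr (real (length xs) * b) * seq_prob W xs ys"
    by (simp add: prod.distrib seq_prob_def powr_power mult.commute)
  finally show ?thesis .
qed

section \<open>Mutual information and capacity in terms of divergence\<close>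

lemma expectation_pmf_finite:
  fixes p :: "'a::finite pmf" and f :: "'a \<Rightarrow> real"
  shows "measure_pmf.expectation p f = (\<Sum>y\<in>UNIV. pmf p y * f y)"
  by (simp add: integral_measure_pmf[of UNIV])

lemma pmf_bind_finite:
  fixes P :: "'x::finite pmf"
  shows "pmf (bind_pmf P V) y = (\<Sum>x\<in>UNIV. pmf P x * pmf (V x) y)"
  by (simp add: pmf_bind expectation_pmf_finite)

lemma mutual_info_eq_kl_div_output:
  fixes P :: "'x::finite pmf"
  shows "mutual_info P V = (\<Sum>x\<in>UNIV. pmf P x * kl_div (V x) (bind_pmf P V))"
  by (simp add: mutual_info_eq kl_div_def info_density_def)

text \<open>Compensation identity: replacing the true output distribution by \<open>q\<close>
  increases the average divergence by exactly the divergence between the two, which is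
  nonnegative.\<close>

lemma mutual_info_le_kl_div:
  fixes P :: "'x::finite pmf" and V :: "'x \<Rightarrow> 'y::finite pmf"
  assumes "\<And>x. set_pmf (V x) \<subseteq> set_pmf q"
  shows "mutual_info P V \<le> (\<Sum>x\<in>UNIV. pmf P x * kl_div (V x) q)"
proof -
  let ?R = "bind_pmf P V"
  have "pmf P x * (pmf (V x) y * log 2 (pmf (V x) y / pmf q y)) =
      pmf P x * (pmf (V x) y * log 2 (pmf (V x) y / pmf ?R y)) +
      pmf P x * pmf (V x) y * log 2 (pmf ?R y / pmf q y)" for x y
  proof (cases "x \<in> set_pmf P \<and> y \<in> set_pmf (V x)")
    case True
    then have "y \<in> set_pmf ?R" "y \<in> set_pmf q" using assms by auto
    then have pos: "pmf ?R y > 0" "pmf q y > 0" "pmf (V x) y > 0"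
      using True by (auto simp only: pmf_positive)
    then have "log 2 (pmf (V x) y / pmf q y) =
        log 2 (pmf (V x) y / pmf ?R y) + log 2 (pmf ?R y / pmf q y)"
      by (simp add: log_divide_pos)
    then show ?thesis by (simp add: algebra_simps)
  qed (auto simp: set_pmf_eq)
  then have "(\<Sum>x\<in>UNIV. pmf P x * kl_div (V x) q) =
      mutual_info P V +
      (\<Sum>x\<in>UNIV. \<Sum>y\<in>UNIV. pmf P x * pmf (V x) y * log 2 (pmf ?R y / pmf q y))"
    by (simp add: mutual_info_eq_kl_div_output kl_div_def sum_distrib_left sum.distrib)
  also have "(\<Sum>x\<in>UNIV. \<Sum>y\<in>UNIV. pmf P x * pmf (V x) y * log 2 (pmf ?R y / pmf q y)) =
      (\<Sum>y\<in>UNIV. (\<Sum>x\<in>UNIV. pmf P x * pmf (V x) y) * log 2 (pmf ?R y / pmf q y))"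
    by (subst sum.swap) (simp add: sum_distrib_right)
  also have "\<dots> = kl_div ?R q"
    by (simp only: kl_div_def pmf_bind_finite)
  finally show ?thesis
    using kl_div_nonneg[of ?R q] assms by auto
qed

text \<open>Any output distribution \<open>q\<close> bounds the capacity by the largest divergence
  of a row from it. The second conclusion also supplies the bounded range that the supremum in
  \<open>capacity\<close> requires.\<close>

lemma capacity_le_kl_div:
  fixes V :: "'x::finite \<Rightarrow> 'y::finite pmf"
  assumes "\<And>x. set_pmf (V x) \<subseteq> set_pmf q" "\<And>x. kl_div (V x) q \<le> c"
  shows "capacity V \<le> c" and "mutual_info P V \<le> c"
proof -
  have le: "mutual_info P V \<le> c" for P
  proof -
    have "mutual_info P V \<le> (\<Sum>x\<in>UNIV. pmf P x * c)"
      by (intro order_trans[OF mutual_info_le_kl_div[OF assms(1)]] sum_mono mult_left_mono assms(2))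
        simp
    then show ?thesis by (simp add: sum_distrib_right[symmetric] sum_pmf_UNIV)
  qed
  then show "mutual_info P V \<le> c" .
  show "capacity V \<le> c" unfolding capacity_def by (intro cSUP_least le) simp
qed

section \<open>Output symmetric channels\<close>

abbreviation uniform_output :: "('x::finite \<Rightarrow> 'y::finite pmf) \<Rightarrow> 'y pmf" where
  "uniform_output W \<equiv> bind_pmf (pmf_of_set UNIV) W"

lemma set_pmf_subset_uniform_output: "set_pmf (W x) \<subseteq> set_pmf (uniform_output W)"
  by auto

lemma pmf_uniform_output:
  "pmf (uniform_output (W :: 'x::finite \<Rightarrow> 'y::finite pmf)) y =
    (\<Sum>x\<in>UNIV. pmf (W x) y) / real CARD('x)"
  by (simp add: pmf_bind_finite sum_divide_distrib)

text \<open>On each block of the partition the column permutations make the uniform output constant,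
  so a row permutation merely rearranges the summands. With \<open>f\<close> arbitrary, the same
  argument serves divergence and variance.\<close>

lemma output_symmetric_sum_eq:
  fixes W :: "'x::finite \<Rightarrow> 'y::finite pmf" and f :: "real \<Rightarrow> real \<Rightarrow> real"
  assumes "output_symmetric W"
  shows "(\<Sum>y\<in>UNIV. f (pmf (W x) y) (pmf (uniform_output W) y)) =
    (\<Sum>y\<in>UNIV. f (pmf (W x') y) (pmf (uniform_output W) y))"
proof -
  let ?q = "pmf (uniform_output W)"
  obtain \<B> where part: "partition_on UNIV \<B>" and sym: "\<forall>B\<in>\<B>.
      (\<forall>x x'. \<exists>\<pi>. \<pi> permutes B \<and> (\<forall>y\<in>B. pmf (W x') y = pmf (W x) (\<pi> y))) \<and>
      (\<forall>y\<in>B. \<forall>y'\<in>B. \<exists>\<pi>. \<pi> permutes UNIV \<and> (\<forall>x. pmf (W x) y' = pmf (W (\<pi> x)) y))"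
    using assms unfolding output_symmetric_def by (elim exE conjE)
  note rows = sym[THEN bspec, THEN conjunct1, rule_format]
  note cols = sym[THEN bspec, THEN conjunct2, THEN bspec, THEN bspec]
  have qconst: "?q y' = ?q y" if B: "B \<in> \<B>" "y \<in> B" "y' \<in> B" for B y y'
  proof -
    obtain \<pi> where \<pi>: "\<pi> permutes UNIV" "\<forall>x. pmf (W x) y' = pmf (W (\<pi> x)) y"
      using cols[OF B] by (elim exE conjE)
    have "(\<Sum>x\<in>UNIV. pmf (W (\<pi> x)) y) = (\<Sum>x\<in>UNIV. pmf (W x) y)"
      using sum.permute[OF \<pi>(1), of "\<lambda>x. pmf (W x) y"] by (simp add: o_def)
    then show ?thesis by (simp only: pmf_uniform_output \<pi>(2)[rule_format])
  qed
  have block: "(\<Sum>y\<in>B. f (pmf (W x) y) (?q y)) = (\<Sum>y\<in>B. f (pmf (W x') y) (?q y))"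
    if B: "B \<in> \<B>" for B
  proof -
    obtain \<pi> where \<pi>: "\<pi> permutes B" "\<forall>y\<in>B. pmf (W x') y = pmf (W x) (\<pi> y)"
      using rows[OF B, of x' x] by (elim exE conjE)
    have "(\<Sum>y\<in>B. f (pmf (W x) y) (?q y)) = (\<Sum>y\<in>B. f (pmf (W x) (\<pi> y)) (?q (\<pi> y)))"
      using sum.permute[OF \<pi>(1), of "\<lambda>y. f (pmf (W x) y) (?q y)"] by (simp add: o_def)
    also have "\<dots> = (\<Sum>y\<in>B. f (pmf (W x') y) (?q y))"
    proof (intro sum.cong refl)
      fix y assume y: "y \<in> B"
      then have "?q (\<pi> y) = ?q y" using y \<pi>(1) by (intro qconst[OF B]) (simp_all only: permutes_in_image)
      then show "f (pmf (W x) (\<pi> y)) (?q (\<pi> y)) = f (pmf (W x') y) (?q y)"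
        by (simp only: \<pi>(2)[rule_format, OF y])
    qed
    finally show ?thesis .
  qed
  have "(\<Sum>y\<in>UNIV. g y) = (\<Sum>B\<in>\<B>. \<Sum>y\<in>B. g y)" for g :: "'y \<Rightarrow> real"
    using sum.Union_disjoint[of \<B> g] partition_onD1[OF part] partition_onD2[OF part]
    by (simp add: disjoint_def)
  then show ?thesis by (simp only: block cong: sum.cong)
qed

lemma output_symmetric_kl_div_eq:
  assumes "output_symmetric W"
  shows "kl_div (W x) (uniform_output W) = kl_div (W x') (uniform_output W)"
  unfolding kl_div_def by (rule output_symmetric_sum_eq[OF assms])

lemma output_symmetric_mutual_info_uniform:
  fixes W :: "'x::finite \<Rightarrow> 'y::finite pmf"
  assumes "output_symmetric W"
  shows "mutual_info (pmf_of_set UNIV) W = kl_div (W x) (uniform_output W)"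
proof -
  have "mutual_info (pmf_of_set UNIV) W =
      (\<Sum>x'\<in>UNIV. pmf (pmf_of_set (UNIV :: 'x set)) x' * kl_div (W x) (uniform_output W))"
    unfolding mutual_info_eq_kl_div_output
    by (intro sum.cong refl) (metis output_symmetric_kl_div_eq[OF assms])
  then show ?thesis by (simp only: sum_distrib_right[symmetric] sum_pmf_UNIV)
qed

text \<open>All rows are equally far from the uniform output, so the upper bound with
  \<open>q = uniform_output W\<close> is met by the uniform input.\<close>

lemma output_symmetric_capacity:
  fixes W :: "'x::finite \<Rightarrow> 'y::finite pmf"
  assumes "output_symmetric W"
  shows "capacity W = kl_div (W x) (uniform_output W)"
proof (rule antisym)
  let ?c = "kl_div (W x) (uniform_output W)"
  note le = set_pmf_subset_uniform_output eq_refl[OF output_symmetric_kl_div_eq[OF assms]]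
  show "capacity W \<le> ?c" by (rule capacity_le_kl_div(1)[OF le])
  have "bdd_above (range (\<lambda>P. mutual_info P W))"
    using capacity_le_kl_div(2)[OF le] by (intro bdd_aboveI2)
  then have "mutual_info (pmf_of_set UNIV) W \<le> capacity W"
    unfolding capacity_def by (intro cSUP_upper) auto
  then show "?c \<le> capacity W" by (simp only: output_symmetric_mutual_info_uniform[OF assms, of x])
qed

section \<open>Variance of the log ratio, and tilting\<close>

text \<open>The divergence variance: the variance under \<open>p\<close> of the log-likelihood
  ratio, whose mean is \<open>kl_div p q\<close>.\<close>

definition log_ratio_var :: "'a::finite pmf \<Rightarrow> 'a pmf \<Rightarrow> real" where
  "log_ratio_var p q = (\<Sum>y\<in>UNIV. pmf p y * (log 2 (pmf p y / pmf q y) - kl_div p q)\<^sup>2)"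

text \<open>The uniform input achieves capacity, so it competes in the infimum, and by symmetry its
  conditional variance is the same for every row. Positive dispersion thus gives every row a
  positive variance.\<close>

lemma output_symmetric_dispersion_le:
  fixes W :: "'x::finite \<Rightarrow> 'y::finite pmf"
  assumes "output_symmetric W"
  shows "dispersion W \<le> log_ratio_var (W x) (uniform_output W)"
proof -
  let ?U = "pmf_of_set UNIV :: 'x pmf"
  let ?q = "uniform_output W"
  let ?var = "\<lambda>P x. measure_pmf.variance (W x) (info_density W P x)"
  have var: "?var ?U x' = log_ratio_var (W x) ?q" for x'
  proof -
    have "?var ?U x' = log_ratio_var (W x') ?q"
      by (simp only: expectation_pmf_finite log_ratio_var_def info_density_def kl_div_def)
    also have "\<dots> = log_ratio_var (W x) ?q"
      unfolding log_ratio_var_def output_symmetric_kl_div_eq[OF assms, of x' x]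
      by (rule output_symmetric_sum_eq[OF assms])
    finally show ?thesis .
  qed
  have mem: "?U \<in> {P. mutual_info P W = capacity W}"
    using output_symmetric_mutual_info_uniform[OF assms] output_symmetric_capacity[OF assms] by simp
  have "dispersion W \<le> measure_pmf.expectation ?U (\<lambda>x. ?var ?U x)"
    unfolding dispersion_def
  proof (rule cINF_lower[OF _ mem])
    show "bdd_below ((\<lambda>P. measure_pmf.expectation P (\<lambda>x. ?var P x)) `
        {P. mutual_info P W = capacity W})"
      by (intro bdd_belowI2[where m = 0] integral_nonneg) auto
  qed
  also have "\<dots> = log_ratio_var (W x) ?q"
    by (simp only: var) simp
  finally show ?thesis .
qed

text \<open>Zero divergence would force \<open>p = q\<close> pointwise, and the log ratio would
  vanish on the support.\<close>

lemma kl_div_pos_of_log_ratio_var: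
  assumes sub: "set_pmf p \<subseteq> set_pmf q" and var: "log_ratio_var p q > 0"
  shows "kl_div p q > 0"
proof (rule ccontr)
  assume "\<not> kl_div p q > 0"
  then have 0: "kl_div p q = 0" using kl_div_nonneg[OF sub] by simp
  then have "pmf p y = pmf q y" for y
    using abs_pmf_diff_le_kl_div[OF sub, of y] by simp
  then have "log_ratio_var p q = 0"
    unfolding log_ratio_var_def 0 by (intro sum.neutral) auto
  then show False using var by simp
qed

text \<open>The witness is \<open>p (1 - a (log (p / q) - D(p || q)))\<close>: the cost is quadratic in \<open>a\<close>, the gain linear.\<close>

lemma exists_tilted_pmf:
  fixes p q :: "'a::finite pmf"
  assumes sub: "set_pmf p \<subseteq> set_pmf q" and "a \<ge> 0"
    and small: "\<And>y. a * \<bar>log 2 (pmf p y / pmf q y) - kl_div p q\<bar> < 1"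
  shows "\<exists>p'. set_pmf p' \<subseteq> set_pmf p \<and>
    kl_div p' p \<le> a\<^sup>2 * log_ratio_var p q / ln 2 \<and>
    kl_div p' q \<le> kl_div p q - a * log_ratio_var p q + a\<^sup>2 * log_ratio_var p q / ln 2"
proof -
  define i where "i y = log 2 (pmf p y / pmf q y)" for y
  define j where "j y = i y - kl_div p q" for y
  \<comment> \<open>The smallness of \<open>a\<close> keeps the tilted weights nonnegative; centring
    \<open>j\<close> keeps their sum equal to 1.\<close>
  have pos: "1 - a * j y > 0" for y
    using small[of y] abs_le_D1[of "a * j y" "a * \<bar>j y\<bar>"] \<open>a \<ge> 0\<close>
    by (simp add: j_def i_def abs_mult)
  have mean: "(\<Sum>y\<in>UNIV. pmf p y * i y) = kl_div p q" by (simp add: kl_div_def i_def)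
  then have mean_j: "(\<Sum>y\<in>UNIV. pmf p y * j y) = 0"
    by (simp add: j_def right_diff_distrib sum_subtractf sum_distrib_right[symmetric] sum_pmf_UNIV)
  have var: "(\<Sum>y\<in>UNIV. pmf p y * (j y)\<^sup>2) = log_ratio_var p q"
    by (simp add: log_ratio_var_def j_def i_def)
  define f where "f y = pmf p y * (1 - a * j y)" for y
  have f0: "f y \<ge> 0" for y using pos[of y] by (simp add: f_def)
  have f1: "(\<Sum>y\<in>UNIV. f y) = 1"
    using mean_j by (simp add: f_def right_diff_distrib sum_subtractf sum_pmf_UNIV
        mult.left_commute[of _ a] sum_distrib_left[symmetric])
  have nn: "(\<integral>\<^sup>+ y. ennreal (f y) \<partial>count_space UNIV) = 1"
    using f0 f1 by (simp add: nn_integral_count_space_finite sum_ennreal)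
  define p' where "p' = embed_pmf f"
  have p': "pmf p' y = f y" for y
    unfolding p'_def by (rule pmf_embed_pmf[OF f0 nn])
  have sub': "set_pmf p' \<subseteq> set_pmf p" by (auto simp: set_pmf_eq p' f_def)
  have "kl_div p' p = (\<Sum>y\<in>UNIV. f y * log 2 (1 - a * j y))"
    unfolding kl_div_def p' by (intro sum.cong) (auto simp: f_def)
  also have "\<dots> \<le> (\<Sum>y\<in>UNIV. f y * (- a * j y / ln 2))"
  proof (intro sum_mono mult_left_mono f0)
    fix y
    show "log 2 (1 - a * j y) \<le> - a * j y / ln 2"
      using divide_right_mono[OF ln_le_minus_one[OF pos[of y]], of "ln 2"] by (simp add: log_def)
  qed
  also have "\<dots> = (\<Sum>y\<in>UNIV. a\<^sup>2 * (pmf p y * (j y)\<^sup>2) - a * (pmf p y * j y)) / ln 2"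
    unfolding sum_divide_distrib
    by (intro sum.cong) (simp_all add: f_def algebra_simps power2_eq_square diff_divide_distrib)
  also have "\<dots> = a\<^sup>2 * log_ratio_var p q / ln 2"
    by (simp add: sum_subtractf sum_distrib_left[symmetric] var mean_j)
  finally have 1: "kl_div p' p \<le> a\<^sup>2 * log_ratio_var p q / ln 2" .
  have "kl_div p' q = (\<Sum>y\<in>UNIV. f y * log 2 (f y / pmf p y) + f y * i y)"
    unfolding kl_div_def p'
  proof (intro sum.cong refl)
    fix y
    show "f y * log 2 (f y / pmf q y) = f y * log 2 (f y / pmf p y) + f y * i y"
    proof (cases "y \<in> set_pmf p")
      case True
      then have "pmf p y > 0" "pmf q y > 0" using sub by (auto simp: pmf_positive)
      moreover have "f y > 0" using \<open>pmf p y > 0\<close> pos by (simp add: f_def)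
      ultimately show ?thesis
        by (simp add: i_def log_divide_pos algebra_simps)
    qed (simp add: f_def set_pmf_eq)
  qed
  also have "\<dots> = kl_div p' p + (\<Sum>y\<in>UNIV. f y * i y)"
    by (simp add: sum.distrib kl_div_def p')
  \<comment> \<open>Writing \<open>i = j + kl_div p q\<close> in the first-order term exposes the
    variance; the remaining part vanishes since \<open>j\<close> has mean 0. This is the linear
    gain.\<close>
  also have "(\<Sum>y\<in>UNIV. f y * i y) =
      (\<Sum>y\<in>UNIV. pmf p y * i y - a * (pmf p y * (j y)\<^sup>2) - a * kl_div p q * (pmf p y * j y))"
    by (intro sum.cong) (auto simp: f_def j_def algebra_simps power2_eq_square)
  also have "\<dots> = kl_div p q - a * log_ratio_var p q"
    by (simp add: sum_subtractf sum_distrib_left[symmetric] var mean_j mean)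
  finally have 2: "kl_div p' q \<le> kl_div p q - a * log_ratio_var p q + a\<^sup>2 * log_ratio_var p q / ln 2"
    using 1 by simp
  show ?thesis using sub' 1 2 by blast
qed

text \<open>Tilt every row away from the same output distribution \<open>?q\<close>. All divergences
  from \<open>?q\<close> then drop together, and so does the capacity bound they provide.\<close>

lemma exists_channel_small_div:
  fixes W :: "'x::finite \<Rightarrow> 'y::finite pmf"
  assumes sym: "output_symmetric W" and disp: "dispersion W > 0"
  shows "\<exists>K>0. \<exists>\<epsilon>\<^sub>0>0. \<forall>\<epsilon>. 0 \<le> \<epsilon> \<longrightarrow> \<epsilon> \<le> \<epsilon>\<^sub>0 \<longrightarrow> (\<exists>V. capacity V \<le> capacity W - \<epsilon> \<and>
    (\<forall>x. set_pmf (V x) \<subseteq> set_pmf (W x) \<and> kl_div (V x) (W x) \<le> K * \<epsilon>\<^sup>2))"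
proof -
  let ?q = "uniform_output W"
  \<comment> \<open>The value is common to all rows, so \<open>undefined\<close> serves as an
    arbitrary input letter.\<close>
  define \<sigma> where "\<sigma> = log_ratio_var (W undefined) ?q"
  have \<sigma>: "log_ratio_var (W x) ?q = \<sigma>" for x
    unfolding \<sigma>_def log_ratio_var_def output_symmetric_kl_div_eq[OF sym, of x undefined]
    by (rule output_symmetric_sum_eq[OF sym])
  have \<sigma>_pos: "\<sigma> > 0"
    using disp output_symmetric_dispersion_le[OF sym, of undefined] by (simp add: \<sigma>_def)
  define J where "J = (\<Sum>x\<in>UNIV. \<Sum>y\<in>UNIV. \<bar>log 2 (pmf (W x) y / pmf ?q y) - kl_div (W x) ?q\<bar>)"
  have J: "\<bar>log 2 (pmf (W x) y / pmf ?q y) - kl_div (W x) ?q\<bar> \<le> J" for x y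
    unfolding J_def
    by (rule order_trans[OF member_le_sum member_le_sum[of x]]) (auto intro: sum_nonneg)
  have J0: "J \<ge> 0" unfolding J_def by (intro sum_nonneg) auto
  \<comment> \<open>The first bound keeps the tilted weights positive, with \<open>J + 1\<close> in
    place of \<open>J\<close> for strictness; the second makes the quadratic loss at most
    \<epsilon>.\<close>
  define \<epsilon>\<^sub>0 where "\<epsilon>\<^sub>0 = min (\<sigma> / (2 * (J + 1))) (\<sigma> * ln 2 / 4)"
  have ln2: "ln (2::real) > 0" by simp
  show ?thesis
  proof (rule exI[of _ "4 / (\<sigma> * ln 2)"], rule conjI[OF _ exI[of _ \<epsilon>\<^sub>0]], goal_cases)
    case 1
    show ?case using \<sigma>_pos ln2 by simp
  next
    case 2
    show ?case
    proof (intro conjI allI impI)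
      show "0 < \<epsilon>\<^sub>0" using \<sigma>_pos J0 ln2 by (simp add: \<epsilon>\<^sub>0_def)
      fix \<epsilon> assume \<epsilon>: "0 \<le> \<epsilon>" "\<epsilon> \<le> \<epsilon>\<^sub>0"
      \<comment> \<open>The linear gain \<open>a * \<sigma>\<close> is then
        \<open>2 * \<epsilon>\<close>, half of which may be spent on the quadratic term.\<close>
      define a where "a = 2 * \<epsilon> / \<sigma>"
      have a0: "a \<ge> 0" using \<epsilon> \<sigma>_pos by (simp add: a_def)
      have e1: "\<epsilon> \<le> \<sigma> / (2 * (J + 1))" and e2: "\<epsilon> \<le> \<sigma> * ln 2 / 4" using \<epsilon> by (auto simp: \<epsilon>\<^sub>0_def)
      have "a * (J + 1) \<le> 1" using e1 \<sigma>_pos J0 by (simp add: a_def field_simps)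
      have small: "a * \<bar>log 2 (pmf (W x) y / pmf ?q y) - kl_div (W x) ?q\<bar> < 1" for x y
      proof (cases "a = 0")
        case False
        have "a * \<bar>log 2 (pmf (W x) y / pmf ?q y) - kl_div (W x) ?q\<bar> \<le> a * J"
          by (intro mult_left_mono J a0)
        also have "\<dots> < a * (J + 1)" using False a0 by simp
        finally show ?thesis using \<open>a * (J + 1) \<le> 1\<close> by simp
      qed simp
      have "\<exists>V. \<forall>x. set_pmf (V x) \<subseteq> set_pmf (W x) \<and> kl_div (V x) (W x) \<le> a\<^sup>2 * \<sigma> / ln 2 \<and>
          kl_div (V x) ?q \<le> capacity W - a * \<sigma> + a\<^sup>2 * \<sigma> / ln 2"
      proof (rule choice, rule allI)
        fix x
        show "\<exists>p'. set_pmf p' \<subseteq> set_pmf (W x) \<and> kl_div p' (W x) \<le> a\<^sup>2 * \<sigma> / ln 2 \<and>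
          kl_div p' ?q \<le> capacity W - a * \<sigma> + a\<^sup>2 * \<sigma> / ln 2"
          using exists_tilted_pmf[OF set_pmf_subset_uniform_output a0 small, of x]
          by (simp only: \<sigma> output_symmetric_capacity[OF sym, of x])
      qed
      then obtain V where V: "\<And>x. set_pmf (V x) \<subseteq> set_pmf (W x)"
        "\<And>x. kl_div (V x) (W x) \<le> a\<^sup>2 * \<sigma> / ln 2"
        "\<And>x. kl_div (V x) ?q \<le> capacity W - a * \<sigma> + a\<^sup>2 * \<sigma> / ln 2"
        by blast
      have sub: "set_pmf (V x) \<subseteq> set_pmf ?q" for x
        using V(1) set_pmf_subset_uniform_output by (rule subset_trans)
      have K: "a\<^sup>2 * \<sigma> / ln 2 = 4 / (\<sigma> * ln 2) * \<epsilon>\<^sup>2"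
        using \<sigma>_pos by (simp add: a_def power2_eq_square field_simps)
      have "4 / (\<sigma> * ln 2) * \<epsilon>\<^sup>2 = \<epsilon> / (\<sigma> * ln 2 / 4) * \<epsilon>"
        by (simp add: power2_eq_square)
      also have "\<dots> \<le> 1 * \<epsilon>"
        using \<epsilon> e2 \<sigma>_pos ln2 by (intro mult_right_mono) auto
      finally have "capacity W - a * \<sigma> + a\<^sup>2 * \<sigma> / ln 2 \<le> capacity W - \<epsilon>"
        unfolding K using \<sigma>_pos by (simp add: a_def)
      then have "capacity V \<le> capacity W - \<epsilon>"
        by (intro capacity_le_kl_div(1)[OF sub] order_trans[OF V(3)])
      then show "\<exists>V. capacity V \<le> capacity W - \<epsilon> \<and>
          (\<forall>x. set_pmf (V x) \<subseteq> set_pmf (W x) \<and> kl_div (V x) (W x) \<le> 4 / (\<sigma> * ln 2) * \<epsilon>\<^sup>2)"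
        using V(1) V(2)[unfolded K] by (intro exI[of _ V]) simp
    qed
  qed
qed

section \<open>The minimizing channel, and positivity of the capacity\<close>

text \<open>\<open>V'\<close> is feasible, so the minimal worst-case divergence is at most
  \<open>c\<close>. Testing it on point masses bounds each row of \<open>V\<close>, and finiteness
  also yields the support inclusion.\<close>

lemma V_star_kl_div_le:
  fixes W :: "'x::finite \<Rightarrow> 'y::finite pmf"
  assumes star: "is_V_star W t T S n V"
    and V': "capacity V' \<le> rate W t n - 2 * delta W t T S n"
    and sub: "\<And>x. set_pmf (V' x) \<subseteq> set_pmf (W x)"
    and le: "\<And>x. kl_div (V' x) (W x) \<le> c"
  shows "set_pmf (V x) \<subseteq> set_pmf (W x)" and "kl_div (V x) (W x) \<le> c"
proof -
  have "cond_div V W (return_pmf x) \<le> (SUP P. cond_div V W P)" by (rule SUP_upper) simp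
  also have "\<dots> \<le> (SUP P. cond_div V' W P)"
    using star V' by (simp add: is_V_star_def is_arg_min_linorder)
  also have "\<dots> \<le> ereal c"
  proof (rule SUP_least)
    fix P :: "'x pmf"
    have "(\<Sum>x\<in>UNIV. pmf P x * kl_div (V' x) (W x)) \<le> (\<Sum>x\<in>UNIV. pmf P x * c)"
      by (intro sum_mono mult_left_mono le) simp
    then show "cond_div V' W P \<le> ereal c"
      by (simp add: cond_div_finite[OF sub] sum_distrib_right[symmetric] sum_pmf_UNIV)
  qed
  finally show "set_pmf (V x) \<subseteq> set_pmf (W x)" "kl_div (V x) (W x) \<le> c"
    by (auto simp: cond_div_return_pmf split: if_splits)
qed

lemma output_symmetric_capacity_pos:
  fixes W :: "'x::finite \<Rightarrow> 'y::finite pmf"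
  assumes "output_symmetric W" "dispersion W > 0"
  shows "capacity W > 0"
  unfolding output_symmetric_capacity[OF assms(1), of undefined]
  by (intro kl_div_pos_of_log_ratio_var set_pmf_subset_uniform_output
      less_le_trans[OF assms(2) output_symmetric_dispersion_le[OF assms(1)]])

section \<open>Asymptotic comparisons\<close>

lemma eventually_exp_powr_le:
  fixes k c a b :: real
  assumes "k > 0" "c > 0" "0 < a" "a < b"
  shows "eventually (\<lambda>n::nat. exp (- k * real n powr b) \<le> c * 2 powr (- 2 * real n powr a)) sequentially"
  using assms by real_asymp

lemma eventually_powr_le_two_powr:
  fixes M t a :: real
  assumes "a > 0"
  shows "eventually (\<lambda>n::nat. M * real n powr t \<le> 2 powr (real n powr a)) sequentially"
  using assms by real_asymp

lemma smallo_powr: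
  fixes a b :: real
  assumes "a < b"
  shows "(\<lambda>n::nat. real n powr a) \<in> o(\<lambda>n. real n powr b)"
  using assms by real_asymp

lemma eventually_powr_minus_le:
  fixes t c :: real
  assumes "0 < t" "0 < c"
  shows "eventually (\<lambda>n::nat. real n powr (- t) \<le> c) sequentially"
  using assms by real_asymp

text \<open>By \<open>- ln d \<le> 1 / d\<close>, the logarithm costs at most one more factor
  \<open>d\<close>. This is the origin of the factor 2 in the exponent of the lower bound on
  \<open>\<delta>'\<close>.\<close>

lemma square_le_div_minus_log2:
  fixes d :: real
  assumes "0 < d" "d < 1"
  shows "ln 2 * d\<^sup>2 \<le> d / (- log 2 d)"
proof -
  have "- ln d > 0" using assms by simp
  have "- ln d \<le> 1 / d"
    using ln_le_minus_one[of "1 / d"] assms by (simp add: ln_div)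
  then have "d\<^sup>2 * (- ln d) \<le> d\<^sup>2 * (1 / d)" by (intro mult_left_mono) auto
  then have "d\<^sup>2 * (- ln d) \<le> d" using assms by (simp add: power2_eq_square)
  then have "d\<^sup>2 \<le> d / (- ln d)" using \<open>- ln d > 0\<close> by (simp only: pos_le_divide_eq)
  then have "ln 2 * d\<^sup>2 \<le> ln 2 * (d / (- ln d))" by (intro mult_left_mono) auto
  also have "\<dots> = d / (- log 2 d)" by (simp add: log_def)
  finally show ?thesis .
qed

section \<open>Pointwise bounds on likelihood ratios, and passage to extended reals\<close>

lemma exists_pmf_lower_bound:
  fixes W :: "'x::finite \<Rightarrow> 'y::finite pmf"
  shows "\<exists>w>0. \<forall>x. \<forall>y\<in>set_pmf (W x). w \<le> pmf (W x) y"
proof -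
  let ?S = "insert 1 ((\<lambda>(x, y). pmf (W x) y) ` (SIGMA x:UNIV. set_pmf (W x)))"
  have fin: "finite ?S" by (intro finite.insertI finite_imageI finite_SigmaI) auto
  then have "Min ?S \<in> ?S" by (intro Min_in) auto
  then have "Min ?S > 0" by (auto simp: pmf_positive)
  moreover have "Min ?S \<le> pmf (W x) y" if "y \<in> set_pmf (W x)" for x y
    using fin that by (intro Min_le) (auto intro!: image_eqI[of _ _ "(x, y)"])
  ultimately show ?thesis by blast
qed

lemma exp2_nonneg: "0 \<le> exp2 a"
  by (simp add: exp2_def)

text \<open>Reduces the extended-real claim to a real inequality: for \<open>d \<le> 0\<close> the
  left side is nonpositive, and an infinite divergence makes the exponential 0.\<close>

lemma ereal_lower_bound:
  fixes V W :: "'x::finite \<Rightarrow> 'y::finite pmf"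
  assumes ne: "xs \<noteq> []"
    and bound: "d > 0 \<Longrightarrow> (\<And>x. x \<in> set xs \<Longrightarrow> set_pmf (V x) \<subseteq> set_pmf (W x)) \<Longrightarrow>
      d / 4 * 2 powr (- (real (length xs) *
        ((\<Sum>x\<in>UNIV. pmf (seq_type xs) x * kl_div (V x) (W x)) + e))) \<le> seq_prob_set W xs A"
  shows "ereal (d / 4) * exp2 (- (ereal (real (length xs)) * (cond_div V W (seq_type xs) + ereal e)))
    \<le> ereal (seq_prob_set W xs A)"
proof -
  let ?E = "exp2 (- (ereal (real (length xs)) * (cond_div V W (seq_type xs) + ereal e)))"
  have W0: "0 \<le> ereal (seq_prob_set W xs A)" by (simp add: seq_prob_set_nonneg)
  consider "d \<le> 0" | "d > 0" "\<exists>x\<in>set xs. \<not> set_pmf (V x) \<subseteq> set_pmf (W x)"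
    | "d > 0" "\<And>x. x \<in> set xs \<Longrightarrow> set_pmf (V x) \<subseteq> set_pmf (W x)"
    by fastforce
  then show ?thesis
  proof cases
    case 1
    then have "ereal (d / 4) * ?E \<le> 0"
      using exp2_nonneg by (simp add: ereal_mult_le_0_iff)
    then show ?thesis using W0 by (rule order_trans)
  next
    case 2
    then have "cond_div V W (seq_type xs) = \<infinity>"
      using cond_div_infinite set_pmf_seq_type[OF ne] by metis
    then have "?E = 0" using ne by (simp add: exp2_def)
    then show ?thesis using W0 by simp
  next
    case 3
    have "cond_div V W (seq_type xs) = ereal (\<Sum>x\<in>UNIV. pmf (seq_type xs) x * kl_div (V x) (W x))"
      using 3(2) set_pmf_seq_type[OF ne] by (intro cond_div_finite) auto
    then show ?thesis using bound[OF 3] by (simp add: exp2_def)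
  qed
qed

text \<open>Treats the finitely many small block lengths. Letterwise \<open>V \<le> W / w\<close>,
  so with so large an \<open>e\<close> the exceptional event of the change of measure is
  empty.\<close>

lemma seq_prob_set_ge_of_pmf_lower_bound:
  fixes V W :: "'x::finite \<Rightarrow> 'y::finite pmf"
  assumes w: "w > 0" "\<And>x y. y \<in> set_pmf (W x) \<Longrightarrow> w \<le> pmf (W x) y"
    and sub: "\<And>x. x \<in> set xs \<Longrightarrow> set_pmf (V x) \<subseteq> set_pmf (W x)"
    and D: "D \<ge> 0" and e: "log 2 (1 / w) \<le> e" and d: "d \<ge> 0"
    and A: "A \<subseteq> {ys. length ys = length xs}" "d / 2 \<le> seq_prob_set V xs A"
  shows "d / 4 * 2 powr (- (real (length xs) * (D + e))) \<le> seq_prob_set W xs A"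
proof (rule change_of_measure[OF A(1) _ A(2)])
  have "pmf (V x) y \<le> 2 powr log 2 (1 / w) * pmf (W x) y" if "x \<in> set xs" for x y
  proof (cases "y \<in> set_pmf (V x)")
    case True
    then have "w \<le> pmf (W x) y" using w sub[OF that] by blast
    moreover have "pmf (V x) y \<le> 1" by (rule pmf_le_1)
    ultimately have "pmf (V x) y * w \<le> 1 * pmf (W x) y"
      using w by (intro mult_mono) auto
    then show ?thesis using w by (simp add: field_simps)
  qed (simp add: set_pmf_eq)
  then have le: "seq_prob V xs ys \<le> 2 powr (real (length xs) * log 2 (1 / w)) * seq_prob W xs ys" for ys
    by (rule seq_prob_le_of_ratio_le)
  have "2 powr (real (length xs) * log 2 (1 / w)) * seq_prob W xs ys
      \<le> 2 powr (real (length xs) * (D + e)) * seq_prob W xs ys" for ys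
    using D e by (intro mult_right_mono powr_mono mult_left_mono) (auto simp: seq_prob_nonneg)
  note le' = order_trans[OF le this]
  have "{ys. length ys = length xs \<and>
      2 powr (real (length xs) * (D + e)) * seq_prob W xs ys < seq_prob V xs ys} = {}"
    using le' by (auto simp: not_less)
  then show "seq_prob_set V xs {ys. length ys = length xs \<and>
      2 powr (real (length xs) * (D + e)) * seq_prob W xs ys < seq_prob V xs ys} \<le> d / 4"
    using d by (simp only:) (simp add: seq_prob_set_def)
qed

text \<open>Dividing the pointwise difference by \<open>w\<close> bounds the relative error
  \<open>u\<close>, and \<open>\<bar>ln (1 + u)\<bar> \<le> 2 * \<bar>u\<bar>\<close> when
  \<open>\<bar>u\<bar> \<le> 1 / 2\<close>.\<close>

lemma abs_ln_pmf_ratio_le: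
  fixes p q :: "'a::finite pmf"
  assumes sub: "set_pmf p \<subseteq> set_pmf q" and y: "y \<in> set_pmf p"
    and w: "w > 0" "w \<le> pmf q y"
    and b: "2 * sqrt (kl_div p q) / w \<le> b" "b \<le> 1 / 2"
  shows "\<bar>ln (pmf p y / pmf q y)\<bar> \<le> 2 * b"
proof -
  define u where "u = (pmf p y - pmf q y) / pmf q y"
  have qpos: "pmf q y > 0" using w by simp
  have "\<bar>u\<bar> = \<bar>pmf p y - pmf q y\<bar> / pmf q y" using qpos by (simp add: u_def)
  also have "\<dots> \<le> (2 * sqrt (kl_div p q)) / w"
    using abs_pmf_diff_le_kl_div[OF sub] w by (intro frac_le) (auto simp: kl_div_nonneg[OF sub])
  finally have ub: "\<bar>u\<bar> \<le> b" using b by linarith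
  then have uh: "\<bar>u\<bar> \<le> 1 / 2" using b by linarith
  have "\<bar>ln (1 + u) - u\<bar> \<le> 2 * u\<^sup>2" by (rule abs_ln_one_plus_x_minus_x_bound[OF uh])
  also have "2 * u\<^sup>2 = (2 * \<bar>u\<bar>) * \<bar>u\<bar>" by (simp add: power2_eq_square abs_mult_self_eq)
  also have "\<dots> \<le> 1 * \<bar>u\<bar>" using uh by (intro mult_right_mono) auto
  finally have "\<bar>ln (1 + u)\<bar> \<le> 2 * \<bar>u\<bar>" by linarith
  moreover have "1 + u = pmf p y / pmf q y" using qpos by (simp add: u_def field_simps)
  ultimately show ?thesis using ub by simp
qed

section \<open>Growth of the parameters\<close>

text \<open>Both arguments of the minimum outgrow \<open>n powr t\<close>: \<open>S\<close> by
  assumption, the other because it is exponential in a positive power of \<open>n\<close>.\<close>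

lemma eventually_S_star_ge:
  assumes "0 < t" "t < 1 / 3" "(\<lambda>n. real (S n)) \<in> \<omega>(\<lambda>n. real n powr t)"
  shows "eventually (\<lambda>n. M * real n powr t \<le> S_star t S n) sequentially"
proof -
  define M' where "M' = max M 1"
  have a: "(1 - 3 * (t + 1 / 2 * (1 / 3 - t))) / 4 > 0" using assms by (simp add: field_simps)
  have "eventually (\<lambda>n. M' * norm (real n powr t) \<le> norm (real (S n))) sequentially"
    by (rule landau_omega.smallD[OF assms(3)]) (simp add: M'_def)
  with eventually_powr_le_two_powr[OF a, of M' t]
  show ?thesis
  proof eventually_elim
    case (elim n)
    have "M * real n powr t \<le> M' * real n powr t"
      by (intro mult_right_mono) (auto simp: M'_def)
    then show ?case using elim by (simp add: S_star_def Let_def)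
  qed
qed

lemma S_star_le: "S_star t S n \<le> 2 powr (real n powr ((1 - 3 * t) / 8))"
proof -
  have "(1 - 3 * (t + 1 / 2 * (1 / 3 - t))) / 4 = (1 - 3 * t) / 8" by (simp add: field_simps)
  then show ?thesis by (simp only: S_star_def Let_def min.cobounded2)
qed

lemma rate_eq:
  assumes "n \<ge> 1"
  shows "rate W t n = capacity W - real n powr (- t)"
  using assms by (simp add: rate_def num_messages_def powr_diff powr_minus field_simps)

lemma eventually_delta_bounds:
  fixes W :: "'x::finite \<Rightarrow> 'y::finite pmf"
  assumes C: "capacity W > 0" and T: "T \<ge> 2" and t: "0 < t" "t < 1 / 3"
    and S: "(\<lambda>n. real (S n)) \<in> \<omega>(\<lambda>n. real n powr t)"
  shows "eventually (\<lambda>n. capacity W - 2 * real n powr (- t) \<le> rate W t n - 2 * delta W t T S n \<and>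
      capacity W / (2 * real T) * 2 powr (- (real n powr ((1 - 3 * t) / 8))) \<le> delta W t T S n \<and>
      delta W t T S n < 1) sequentially"
proof -
  let ?C = "capacity W"
  \<comment> \<open>Chosen so that \<open>S_star \<ge> M * n powr t\<close> gives
    \<open>delta \<le> n powr (- t) / 2\<close>.\<close>
  define M where "M = 2 * (real T - 1) * ?C"
  have M: "M > 0" using C T by (simp add: M_def)
  \<comment> \<open>Below \<open>?C / 2\<close>, the term \<open>n powr (- t)\<close> leaves at
    least half of the capacity as rate; below 1, it gives \<open>delta < 1\<close>.\<close>
  have "min (?C / 2) 1 > 0" using C by simp
  from eventually_powr_minus_le[OF t(1) this] eventually_S_star_ge[OF t S, of M]
    eventually_ge_at_top[of 1]
  show ?thesis
  proof eventually_elim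
    case (elim n)
    have n: "n \<ge> 1" using elim by simp
    define r where "r = rate W t n"
    have r: "r = ?C - real n powr (- t)" unfolding r_def by (rule rate_eq[OF n])
    have npos: "real n powr t > 0" using n by simp
    have rC: "?C / 2 \<le> r" "r \<le> ?C" using elim r by auto
    let ?s = "S_star t S n"
    have s: "M * real n powr t \<le> ?s" using elim by simp
    have s0: "?s > 0" using s M npos by (meson less_le_trans mult_pos_pos)
    have d: "delta W t T S n = (real T - 1) * r / (?s + real T - 1)" by (simp add: delta_def r_def)
    have "delta W t T S n \<le> (real T - 1) * ?C / (M * real n powr t)"
      unfolding d using C T rC s npos M by (intro frac_le mult_left_mono) auto
    also have "\<dots> = real n powr (- t) / 2"
      using C T npos by (simp add: M_def powr_minus field_simps)
    finally have up: "delta W t T S n \<le> real n powr (- t) / 2" .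
    let ?p = "2 powr (real n powr ((1 - 3 * t) / 8))"
    have p: "?s \<le> ?p" by (rule S_star_le)
    have "?p \<ge> 1" by (intro ge_one_powr_ge_zero) auto
    then have "(real T - 1) * 1 \<le> (real T - 1) * ?p" using T by (intro mult_left_mono) auto
    then have den: "?s + real T - 1 \<le> real T * ?p" using p by (simp add: algebra_simps)
    have "?C / (2 * real T) * 2 powr (- (real n powr ((1 - 3 * t) / 8))) = (?C / 2) / (real T * ?p)"
      by (simp add: powr_minus field_simps)
    also have "\<dots> \<le> ((real T - 1) * r) / (?s + real T - 1)"
    proof (rule frac_le)
      have "1 * r \<le> (real T - 1) * r" using T rC C by (intro mult_right_mono) auto
      then show "?C / 2 \<le> (real T - 1) * r" using rC by simp
      then show "0 \<le> (real T - 1) * r" using C by linarith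
      show "0 < ?s + real T - 1" using s0 T by simp
    qed (rule den)
    finally have low: "?C / (2 * real T) * 2 powr (- (real n powr ((1 - 3 * t) / 8))) \<le> delta W t T S n"
      unfolding d .
    show ?case using up low r elim(1) by (simp add: r_def)
  qed
qed

text \<open>Asymptotic bounds compare norms, hence the absolute value; the sign of
  \<open>\<delta>'\<close> is settled later, in the case where it is positive. The truncation in
  \<open>S_star\<close> bounds \<open>delta\<close> from below.\<close>

lemma eventually_abs_delta'_ge:
  fixes W :: "'x::finite \<Rightarrow> 'y::finite pmf"
  assumes C: "capacity W > 0" and T: "T \<ge> 2" and t: "0 < t" "t < 1 / 3"
    and S: "(\<lambda>n. real (S n)) \<in> \<omega>(\<lambda>n. real n powr t)"
    and \<delta>': "\<delta>' \<in> \<Omega>(\<lambda>n. delta W t T S n / (- log 2 (delta W t T S n)))"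
  shows "\<exists>c>0. eventually (\<lambda>n. c * 2 powr (- 2 * real n powr ((1 - 3 * t) / 8)) \<le> \<bar>\<delta>' n\<bar>) sequentially"
proof -
  obtain k where k: "k > 0" and ev: "eventually (\<lambda>n. k *
      norm (delta W t T S n / (- log 2 (delta W t T S n))) \<le> norm (\<delta>' n)) sequentially"
    using landau_omega.bigE[OF \<delta>'] by blast
  define b where "b = capacity W / (2 * real T)"
  have b: "b > 0" using C T by (simp add: b_def)
  show ?thesis
  proof (intro exI[of _ "k * (ln 2 * b\<^sup>2)"] conjI)
    show "0 < k * (ln 2 * b\<^sup>2)" using k b by simp
    from ev eventually_delta_bounds[OF C T t S]
    show "eventually (\<lambda>n. k * (ln 2 * b\<^sup>2) * 2 powr (- 2 * real n powr ((1 - 3 * t) / 8)) \<le> \<bar>\<delta>' n\<bar>)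
      sequentially"
    proof eventually_elim
      case (elim n)
      let ?d = "delta W t T S n"
      let ?p = "2 powr (- (real n powr ((1 - 3 * t) / 8)))"
      have low: "b * ?p \<le> ?d" and "?d < 1" using elim by (auto simp: b_def)
      have "0 < b * ?p" using b by simp
      then have d0: "?d > 0" using low by linarith
      have "2 powr (- 2 * real n powr ((1 - 3 * t) / 8)) = ?p\<^sup>2"
        by (simp add: power2_eq_square powr_add[symmetric])
      then have "k * (ln 2 * b\<^sup>2) * 2 powr (- 2 * real n powr ((1 - 3 * t) / 8)) =
          k * (ln 2 * (b * ?p)\<^sup>2)"
        by (simp add: power_mult_distrib)
      also have "\<dots> \<le> k * (ln 2 * ?d\<^sup>2)"
        using low k b by (intro mult_left_mono power_mono) auto
      also have "\<dots> \<le> k * (?d / (- log 2 ?d))"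
        using k square_le_div_minus_log2[OF d0 \<open>?d < 1\<close>] by (intro mult_left_mono) auto
      also have "\<dots> \<le> k * norm (?d / (- log 2 ?d))"
        unfolding real_norm_def using k by (intro mult_left_mono abs_ge_self) simp
      also have "\<dots> \<le> \<bar>\<delta>' n\<bar>" using elim by simp
      finally show ?case .
    qed
  qed
qed

section \<open>Assembling the bounds\<close>

lemma eventually_V_star_kl_div_le:
  fixes W :: "'x::finite \<Rightarrow> 'y::finite pmf"
  assumes sym: "output_symmetric W" and disp: "dispersion W > 0"
    and T: "T \<ge> 2" and t: "0 < t" "t < 1 / 3"
    and S: "(\<lambda>n. real (S n)) \<in> \<omega>(\<lambda>n. real n powr t)"
    and V: "eventually (\<lambda>n. is_V_star W t T S n (V n)) sequentially"
  shows "\<exists>K>0. eventually (\<lambda>n. \<forall>x. set_pmf (V n x) \<subseteq> set_pmf (W x) \<and>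
      kl_div (V n x) (W x) \<le> K * real n powr (- 2 * t)) sequentially"
proof -
  obtain K \<epsilon>\<^sub>0 where K: "K > 0" "\<epsilon>\<^sub>0 > 0" and ex: "\<And>\<epsilon>. 0 \<le> \<epsilon> \<Longrightarrow> \<epsilon> \<le> \<epsilon>\<^sub>0 \<Longrightarrow>
      \<exists>V. capacity V \<le> capacity W - \<epsilon> \<and>
        (\<forall>x. set_pmf (V x) \<subseteq> set_pmf (W x) \<and> kl_div (V x) (W x) \<le> K * \<epsilon>\<^sup>2)"
    using exists_channel_small_div[OF sym disp] by blast
  have "\<epsilon>\<^sub>0 / 2 > 0" using K by simp
  from eventually_powr_minus_le[OF t(1) this] V
    eventually_delta_bounds[OF output_symmetric_capacity_pos[OF sym disp] T t S]
  have "eventually (\<lambda>n. \<forall>x. set_pmf (V n x) \<subseteq> set_pmf (W x) \<and>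
      kl_div (V n x) (W x) \<le> 4 * K * real n powr (- 2 * t)) sequentially"
  proof eventually_elim
    case (elim n)
    \<comment> \<open>One \<open>n powr (- t)\<close> covers the gap between rate and capacity, the
      other covers \<open>2 * delta\<close>.\<close>
    define \<epsilon> where "\<epsilon> = 2 * real n powr (- t)"
    have "0 \<le> \<epsilon>" "\<epsilon> \<le> \<epsilon>\<^sub>0" using elim(1) by (auto simp: \<epsilon>_def)
    then obtain V' where V': "capacity V' \<le> capacity W - \<epsilon>"
      "\<And>x. set_pmf (V' x) \<subseteq> set_pmf (W x)" "\<And>x. kl_div (V' x) (W x) \<le> K * \<epsilon>\<^sup>2"
      using ex by blast
    have "capacity V' \<le> rate W t n - 2 * delta W t T S n"
      using V'(1) elim(3) by (simp add: \<epsilon>_def)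
    note le = V_star_kl_div_le[OF elim(2) this V'(2,3)]
    have "\<epsilon>\<^sup>2 = 4 * real n powr (- 2 * t)"
      by (simp add: \<epsilon>_def power2_eq_square powr_add[symmetric])
    then show ?case using le by (simp add: mult_ac)
  qed
  then show ?thesis using K(1) by (intro exI[of _ "4 * K"]) auto
qed

lemma eventually_seq_prob_set_ge:
  fixes W :: "'x::finite \<Rightarrow> 'y::finite pmf" and V :: "nat \<Rightarrow> 'x \<Rightarrow> 'y pmf"
  assumes T: "T \<ge> 1" and t: "0 < t" "t < 1 / 3" and c: "c > 0" and K: "K > 0"
    and d: "eventually (\<lambda>n. c * 2 powr (- 2 * real n powr ((1 - 3 * t) / 8)) \<le> \<bar>d n\<bar>) sequentially"
    and V: "eventually (\<lambda>n. \<forall>x. set_pmf (V n x) \<subseteq> set_pmf (W x) \<and>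
      kl_div (V n x) (W x) \<le> K * real n powr (- 2 * t)) sequentially"
  shows "eventually (\<lambda>n. \<forall>xs A. length xs = T * n \<longrightarrow> A \<subseteq> {ys. length ys = length xs} \<longrightarrow>
      d n / 2 \<le> seq_prob_set (V n) xs A \<longrightarrow> d n > 0 \<longrightarrow>
      d n / 4 * 2 powr (- (real (length xs) *
        ((\<Sum>x\<in>UNIV. pmf (seq_type xs) x * kl_div (V n x) (W x)) +
          real n powr (- 2 * t - (1 - 3 * t) / 4)))) \<le> seq_prob_set W xs A) sequentially"
proof -
  \<comment> \<open>Positive exactly because \<open>t < 1/3\<close>; it makes the slack
    \<open>n powr (- 2 * t - \<epsilon>)\<close> of smaller order than
    \<open>n powr (- 2 * t)\<close>.\<close>
  define \<epsilon> where "\<epsilon> = (1 - 3 * t) / 4"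
  have \<epsilon>: "\<epsilon> > 0" using t by (simp add: \<epsilon>_def)
  obtain w where w: "w > 0" "\<And>x y. y \<in> set_pmf (W x) \<Longrightarrow> w \<le> pmf (W x) y"
    using exists_pmf_lower_bound[of W] by blast
  define b where "b = 2 * sqrt K / w"
  have b: "b > 0" using K w by (simp add: b_def)
  \<comment> \<open>The first summand makes the quadratic Chernoff error at most half of the linear
    gain; the second ensures \<open>s * ?B \<le> 1\<close>.\<close>
  define M where "M = 8 * b\<^sup>2 / ln 2 + 2 * b"
  have ln2: "ln (2::real) > 0" by simp
  have M: "M > 0" "2 * b \<le> M" using b ln2 by (auto simp: M_def intro: add_nonneg_pos)
  have "8 * b\<^sup>2 / ln 2 \<le> M" using b by (simp add: M_def)
  then have M2: "8 * b\<^sup>2 \<le> M * ln 2" using ln2 by (simp only: pos_divide_le_eq)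
  define k where "k = ln 2 / (2 * M)"
  have k: "k > 0" using M ln2 by (simp add: k_def)
  have b2: "1 / (2 * b) > 0" using b by simp
  have ab: "0 < (1 - 3 * t) / 8" "(1 - 3 * t) / 8 < (1 - t) / 2" using t by auto
  have c4: "c / 4 > 0" using c by simp
  from d V eventually_powr_minus_le[OF t(1) b2] eventually_exp_powr_le[OF k c4 ab]
    eventually_ge_at_top[of 1]
  show ?thesis
  proof eventually_elim
    case (elim n)
    note dn = elim(1) and Vn = elim(2)[rule_format] and nb = elim(3) and tail = elim(4)
      and n = elim(5)
    show ?case
    proof (intro allI impI)
      fix xs A
      assume xs: "length xs = T * n" and A: "A \<subseteq> {ys. length ys = length xs}"
        and ge: "d n / 2 \<le> seq_prob_set (V n) xs A" and pos: "d n > 0"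
      then have n0: "real n > 0" and n1: "real n \<ge> 1" using n by auto
      have ne: "xs \<noteq> []" using xs n T by auto
      let ?D = "\<Sum>x\<in>UNIV. pmf (seq_type xs) x * kl_div (V n x) (W x)"
      let ?e = "real n powr (- 2 * t - \<epsilon>)"
      let ?B = "2 * (b * real n powr (- t))"
      \<comment> \<open>With this \<open>s\<close>, both \<open>s\<^sup>2 * ?B\<^sup>2\<close> and
        \<open>s * ?e\<close> are multiples of \<open>n powr (- 2 * t - 2 * \<epsilon>)\<close>, and
        \<open>M\<close> decides which dominates.\<close>
      define s where "s = real n powr (- \<epsilon>) / M"
      have B: "\<bar>ln (pmf (V n x) y / pmf (W x) y)\<bar> \<le> ?B" if y: "y \<in> set_pmf (V n x)" for x y
      proof (rule abs_ln_pmf_ratio_le[OF _ y w(1)])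
        show sub: "set_pmf (V n x) \<subseteq> set_pmf (W x)" using Vn by blast
        show "w \<le> pmf (W x) y" using w(2) y sub by blast
        have "sqrt (kl_div (V n x) (W x)) \<le> sqrt (K * real n powr (- 2 * t))"
          using Vn by (intro real_sqrt_le_mono) blast
        also have "real n powr (- 2 * t) = (real n powr (- t))\<^sup>2"
          by (simp add: power2_eq_square powr_add[symmetric])
        also have "sqrt (K * (real n powr (- t))\<^sup>2) = sqrt K * real n powr (- t)"
          by (simp add: real_sqrt_mult)
        finally show "2 * sqrt (kl_div (V n x) (W x)) / w \<le> b * real n powr (- t)"
          using w(1) by (simp add: b_def divide_right_mono)
        show "b * real n powr (- t) \<le> 1 / 2"
          using mult_left_mono[OF nb, of b] b by simp
      qed
      have s0: "s \<ge> 0" using M by (simp add: s_def)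
      have sB: "s * ?B \<le> 1"
      proof -
        have "real n powr (- \<epsilon>) \<le> 1" "real n powr (- t) \<le> 1"
          using n1 \<epsilon> t powr_mono[of "- \<epsilon>" 0 "real n"] powr_mono[of "- t" 0 "real n"] by auto
        then have "real n powr (- \<epsilon>) * (2 * b * real n powr (- t)) \<le> 1 * (M * 1)"
          using M b by (intro mult_mono) auto
        then show ?thesis using M by (simp add: s_def field_simps)
      qed
      have "seq_prob_set (V n) xs {ys. length ys = length xs \<and>
          2 powr (real (length xs) * (?D + ?e)) * seq_prob W xs ys < seq_prob (V n) xs ys}
        \<le> exp (real (length xs) * (s\<^sup>2 * ?B\<^sup>2 - s * ln 2 * ?e))"
        using Vn by (intro likelihood_ratio_tail[OF ne _ B s0 sB refl]) auto
      also have "\<dots> \<le> exp (- k * real n powr ((1 - t) / 2))"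
      proof -
        define u where "u = real n powr (- 2 * t - 2 * \<epsilon>)"
        have u': "u = real n powr (- (2 * \<epsilon>) - 2 * t)" 
          unfolding u_def by (rule arg_cong) simp
        have "s\<^sup>2 * ?B\<^sup>2 = 4 * b\<^sup>2 / M\<^sup>2 * u"
          by (simp add: s_def u' power2_eq_square powr_add[symmetric])
        moreover have "s * ln 2 * ?e = ln 2 / M * u"
          by (simp add: s_def u' powr_add[symmetric])
        moreover have "4 * b\<^sup>2 / M\<^sup>2 \<le> ln 2 / (2 * M)"
          using M2 M by (simp add: field_simps power2_eq_square)
        then have "4 * b\<^sup>2 / M\<^sup>2 * u \<le> ln 2 / (2 * M) * u" by (intro mult_right_mono) (auto simp: u_def)
        moreover have "ln 2 / (2 * M) * u = k * u" "ln 2 / M * u = 2 * (k * u)"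
          by (simp_all add: k_def)
        ultimately have "s\<^sup>2 * ?B\<^sup>2 - s * ln 2 * ?e \<le> - k * u"
          by linarith
        then have "real (length xs) * (s\<^sup>2 * ?B\<^sup>2 - s * ln 2 * ?e) \<le> real (length xs) * (- k * u)"
          by (intro mult_left_mono) auto
        also have "\<dots> = - (real T * (k * (real n * u)))" using xs by simp
        also have "real n * u = real n powr (1 + (- 2 * t - 2 * \<epsilon>))"
          using n0 by (simp add: u_def powr_add)
        \<comment> \<open>The resulting power exceeds the exponent \<open>(1 - 3 * t) / 8\<close> in
          the lower bound on \<open>d\<close>, so the tail is eventually negligible.\<close>
        also have "1 + (- 2 * t - 2 * \<epsilon>) = (1 - t) / 2" by (simp add: \<epsilon>_def field_simps)
        also have "- (real T * (k * real n powr ((1 - t) / 2))) \<le> - (1 * (k * real n powr ((1 - t) / 2)))"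
          using T k by (intro le_imp_neg_le mult_right_mono) auto
        finally show ?thesis by simp
      qed
      also have "\<dots> \<le> c / 4 * 2 powr (- 2 * real n powr ((1 - 3 * t) / 8))" by (rule tail)
      also have "\<dots> \<le> d n / 4" using dn pos by simp
      finally have "d n / 4 * 2 powr (- (real (length xs) * (?D + ?e))) \<le> seq_prob_set W xs A"
        by (rule change_of_measure[OF A _ ge])
      then show "d n / 4 * 2 powr (- (real (length xs) *
          (?D + real n powr (- 2 * t - (1 - 3 * t) / 4)))) \<le> seq_prob_set W xs A"
        by (simp add: \<epsilon>_def)
    qed
  qed
qed

theorem lemma7:
  fixes W :: "'x::finite \<Rightarrow> 'y::finite pmf"
    and T n0 :: nat and t :: real
    and S :: "nat \<Rightarrow> nat"
    and V :: "nat \<Rightarrow> 'x \<Rightarrow> 'y pmf"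
    and \<phi> :: "nat \<Rightarrow> nat \<Rightarrow> nat list \<Rightarrow> 'x list"
    and \<psi> :: "nat \<Rightarrow> nat \<Rightarrow> nat list \<Rightarrow> 'y list \<Rightarrow> nat"
    and \<delta>' :: "nat \<Rightarrow> real"
  assumes "output_symmetric W" and "dispersion W > 0"
    and "T \<ge> 2" and "0 < t" and "t < 1/3"
    and "n0 \<ge> 1"
    and "\<And>n. n \<ge> n0 \<Longrightarrow> S n \<ge> 1"
    and "(\<lambda>n. real (S n)) \<in> \<omega>(\<lambda>n. real n powr t)"
    and "\<And>n. n \<ge> n0 \<Longrightarrow> is_V_star W t T S n (V n)"
    and "\<And>n. n \<ge> n0 \<Longrightarrow> encoder (message_set W t n) (S n) T n (\<phi> n)"
    and "\<And>n. n \<ge> n0 \<Longrightarrow> optimal_decoder W (message_set W t n) (S n) T n (\<phi> n) (\<psi> n)"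
    and "\<delta>' \<in> \<Theta>(\<lambda>n. delta W t T S n / (- log 2 (delta W t T S n)))"
    and "\<And>n. n \<ge> n0 \<Longrightarrow>
           Max ((\<lambda>k. error_prob (V n) (message_set W t n) (S n) T n (\<phi> n) k (latest n k (\<psi> n k)))
                ` {k. 1 \<le> k \<and> real k \<le> S_star t S n}) \<ge> \<delta>' n"
  shows "\<exists>\<eta>. (\<forall>n. \<eta> n > 0) \<and> \<eta> \<in> o(\<lambda>n. real n powr (- 2 * t)) \<and>
           (\<forall>n\<ge>n0. \<forall>xs. \<forall>A. length xs = T * n \<longrightarrow> A \<subseteq> {ys. length ys = T * n} \<longrightarrow>
              seq_prob_set (V n) xs A \<ge> \<delta>' n / 2 \<longrightarrow>
              ereal (seq_prob_set W xs A) \<ge>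
                ereal (\<delta>' n / 4) *
                exp2 (- (ereal (real (T * n)) * (cond_div (V n) W (seq_type xs) + ereal (\<eta> n)))))"
proof -
  note sym = assms(1) and disp = assms(2) and T = assms(3) and t = assms(4,5)
    and n0 = assms(6) and S = assms(8)
  let ?e = "\<lambda>n. real n powr (- 2 * t - (1 - 3 * t) / 4)"
  have T1: "T \<ge> 1" using T by simp
  have star: "eventually (\<lambda>n. is_V_star W t T S n (V n)) sequentially"
    using assms(9) by (auto simp: eventually_sequentially)
  have "\<delta>' \<in> \<Omega>(\<lambda>n. delta W t T S n / (- log 2 (delta W t T S n)))"
    using assms(12) by (rule bigthetaD2)
  from eventually_abs_delta'_ge[OF output_symmetric_capacity_pos[OF sym disp] T t S this]
  obtain c where c: "c > 0" "eventually (\<lambda>n. c * 2 powr (- 2 * real n powr ((1 - 3 * t) / 8)) \<le> \<bar>\<delta>' n\<bar>)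
      sequentially" by blast
  from eventually_V_star_kl_div_le[OF sym disp T t S star]
  obtain K where K: "K > 0" "eventually (\<lambda>n. \<forall>x. set_pmf (V n x) \<subseteq> set_pmf (W x) \<and>
      kl_div (V n x) (W x) \<le> K * real n powr (- 2 * t)) sequentially" by blast
  \<comment> \<open>Including \<open>n \<ge> 1\<close> keeps \<open>?e n\<close> positive, since
    \<open>0 powr a = 0\<close>.\<close>
  from eventually_conj[OF eventually_ge_at_top[of 1] eventually_seq_prob_set_ge[OF T1 t c(1) K(1) c(2) K(2)]]
  obtain N where N: "\<And>n. n \<ge> N \<Longrightarrow> n \<ge> 1" and large: "\<And>n xs A. n \<ge> N \<Longrightarrow> length xs = T * n \<Longrightarrow>
      A \<subseteq> {ys. length ys = length xs} \<Longrightarrow> \<delta>' n / 2 \<le> seq_prob_set (V n) xs A \<Longrightarrow> \<delta>' n > 0 \<Longrightarrow>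
      \<delta>' n / 4 * 2 powr (- (real (length xs) *
        ((\<Sum>x\<in>UNIV. pmf (seq_type xs) x * kl_div (V n x) (W x)) + ?e n))) \<le> seq_prob_set W xs A"
    unfolding eventually_sequentially by blast
  obtain w where w: "w > 0" "\<And>x y. y \<in> set_pmf (W x) \<Longrightarrow> w \<le> pmf (W x) y"
    using exists_pmf_lower_bound[of W] by blast
  \<comment> \<open>Below the threshold \<open>N\<close> a constant suffices:
    \<open>log 2 (1 / w)\<close> feeds the crude bound, and the maximum with 1 keeps the value
    positive. Finitely many values do not affect the asymptotics.\<close>
  define \<eta> where "\<eta> n = (if n \<ge> N then ?e n else max 1 (log 2 (1 / w)))" for n
  show ?thesis
  proof (intro exI[of _ \<eta>] conjI allI impI)
    show "\<eta> n > 0" for n using N[of n] by (auto simp: \<eta>_def)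
    have "eventually (\<lambda>n. \<eta> n = ?e n) sequentially"
      unfolding eventually_sequentially \<eta>_def by auto
    then show "\<eta> \<in> o(\<lambda>n. real n powr (- 2 * t))"
      by (rule landau_o.small.in_cong[THEN iffD2]) (use t in \<open>intro smallo_powr; simp\<close>)
  next
    fix n xs A
    assume n: "n \<ge> n0" and xs: "length xs = T * n" and A: "A \<subseteq> {ys. length ys = T * n}"
      and ge: "\<delta>' n / 2 \<le> seq_prob_set (V n) xs A"
    have ne: "xs \<noteq> []" using xs n n0 T by auto
    have A': "A \<subseteq> {ys. length ys = length xs}" using A xs by simp
    have "\<delta>' n / 4 * 2 powr (- (real (length xs) *
        ((\<Sum>x\<in>UNIV. pmf (seq_type xs) x * kl_div (V n x) (W x)) + \<eta> n))) \<le> seq_prob_set W xs A"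
      if pos: "\<delta>' n > 0" and sub: "\<And>x. x \<in> set xs \<Longrightarrow> set_pmf (V n x) \<subseteq> set_pmf (W x)"
    proof (cases "n \<ge> N")
      case True
      then show ?thesis using large[OF True xs A' ge pos] by (simp only: \<eta>_def if_True)
    next
      case False
      \<comment> \<open>The support inclusion is available only for letters of \<open>xs\<close>;
        every other letter has weight 0 in the type.\<close>
      have "pmf (seq_type xs) x * kl_div (V n x) (W x) \<ge> 0" for x
      proof (cases "x \<in> set xs")
        case True
        show ?thesis by (intro mult_nonneg_nonneg kl_div_nonneg sub True) simp
      next
        case False
        then have "pmf (seq_type xs) x = 0"
          by (simp only: set_pmf_iff set_pmf_seq_type[OF ne, symmetric] not_not)
        then show ?thesis by simp
      qed
      then have "(\<Sum>x\<in>UNIV. pmf (seq_type xs) x * kl_div (V n x) (W x)) \<ge> 0" by (intro sum_nonneg)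
      then show ?thesis
        using False pos
        by (intro seq_prob_set_ge_of_pmf_lower_bound[OF w sub _ _ _ A' ge]) (simp_all add: \<eta>_def)
    qed
    then show "ereal (\<delta>' n / 4) *
        exp2 (- (ereal (real (T * n)) * (cond_div (V n) W (seq_type xs) + ereal (\<eta> n))))
      \<le> ereal (seq_prob_set W xs A)"
      using ereal_lower_bound[OF ne, where V = "V n" and W = W and A = A] by (simp only: xs)
  qed
qed

end
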